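(* Let $\{F_t\}_{t\ge0}$ be a one-dimensional symmetric nice Feller process with symbol $q(x,\xi)$ and Lévy measure $\nu(x,dy)$, and put $N(x,y):=\nu(x,(y,\infty))$ for $x\in\mathbb{R}$, $y\ge0$. Assume that (i) $\nu(x,dy)$ is quasi-unimodal uniformly in $x\in\mathbb{R}$; (ii) the function $x\mapsto\nu(x,O-x)$ is lower semicontinuous for every open set $O\subseteq\mathbb{R}$, that is, $\liminf_{y\to x}\nu(y,O-y)\ge\nu(x,O-x)$ for all $x\in\mathbb{R}$ and all open sets $O\subseteq\mathbb{R}$. Then, for arbitrary $\rho>0$, $$\int_\rho^\infty\left(\sup_{x\in\mathbb{R}}\int_0^r yN(x,y)\,dy\right)^{-1}dr=\infty$$ if, and only if, $\int_{\{|\xi|<s\}}\frac{d\xi}{\sup_{x\in\mathbb{R}}|q(x,\xi)|}=\infty$ for some $s>0$. Further, if $\lim_{\xi\to0}\frac{\inf_{x\in\mathbb{R}}q(x,\xi)}{\xi^2}=\infty$ and $\inf_{x\in\mathbb{R}}\int_{y_0}^\infty y\,\nu(x,(y,\infty))\,dy>0$ for some $y_0>0$, then $$\int_\rho^\infty\left(\inf_{x\in\mathbb{R}}\int_0^r yN(x,y)\,dy\right)^{-1}dr<\infty\quad\text{for all }\rho>0\text{ large enough}$$ if, and only if, $\int_{\{|\xi|<s\}}\frac{d\xi}{\inf_{x\in\mathbb{R}}q(x,\xi)}<\infty$ for some $s>0$.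
   Context: A symmetric Borel measure $\mu$ on $\mathbb{R}$ is quasi-unimodal if there is $y_0\ge0$ such that $y\mapsto\mu((y,\infty))$ is a (finite) convex function on $(y_0,\infty)$. A kernel $\nu(x,dy)$ of symmetric measures is quasi-unimodal uniformly in $x$ if one $y_0\ge0$ works for all $\nu(x,\cdot)$, $x\in\mathbb{R}$. A Feller process $\{F_t\}_{t\ge0}$ on $\mathbb{R}$ is a Markov process with state space $(\mathbb{R},\mathcal{B}(\mathbb{R}))$, with laws $\mathbb{P}^x$ and expectations $\mathbb{E}^x$, whose semigroup $P_tf(x)=\mathbb{E}^x[f(F_t)]$ maps $C_\infty(\mathbb{R})$ (continuous functions vanishing at infinity, with the supremum norm) into itself and is strongly continuous there; it is strong Markov with càdlàg paths. Let $(\mathcal{A},\mathcal{D}_{\mathcal{A}})$ be its generator. Condition (C1): $C_c^\infty(\mathbb{R})\subseteq\mathcal{D}_{\mathcal{A}}$; then for $f\in C_c^\infty(\mathbb{R})$, $\mathcal{A}f(x)=-\int_{\mathbb{R}}q(x,\xi)e^{i\xi x}\hat f(\xi)\,d\xi$, $\hat f(\xi)=(2\pi)^{-1}\int e^{-i\xi x}f(x)\,dx$, where the symbol $q$ has a Lévy-Khintchine representation $q(x,\xi)=a(x)-i\xi b(x)+\frac12c(x)\xi^2-\int_{\mathbb{R}}(e^{i\xi y}-1-i\xi y1_{\{|y|\le1\}})\nu(x,dy)$, with $a,c\ge0$ and $b$ real-valued Borel functions and $\nu(x,dy)$ a Borel kernel (the Lévy measure) with $\nu(x,\{0\})=0$,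 $\int\min\{1,y^2\}\nu(x,dy)<\infty$. Condition (C2): for some $C\ge0$, $\sup_x|q(x,\xi)|\le C(1+\xi^2)$ for all $\xi$; equivalently $a$, $b$, $c$ and $x\mapsto\int\min\{1,y^2\}\nu(x,dy)$ are bounded. Condition (C3): $q(x,0)=a(x)=0$ for all $x$. For a $\sigma$-finite measure $\varphi$ the process is $\varphi$-irreducible if $\varphi(B)>0$ implies $\int_0^\infty\mathbb{P}^x(F_t\in B)\,dt>0$ for all $x$; then there is a maximal irreducibility measure $\psi$ (the process is $\bar\varphi$-irreducible iff $\bar\varphi\ll\psi$). Condition (C4): the process is irreducible and $\psi(O)>0$ for every nonempty open $O\subseteq\mathbb{R}$. A nice Feller process is a Feller process satisfying (C1)-(C4). It is symmetric if $q=\operatorname{Re}q$, i.e. $b=0$ and each $\nu(x,dy)$ is a symmetric measure, so that $q(x,\xi)=\frac12c(x)\xi^2+\int_{\mathbb{R}}(1-\cos\xi y)\nu(x,dy)\ge0$. Convention: $1/0=\infty$ in integrands. *)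

theory Defs
  imports "HOL-Probability.Probability"
begin

section \<open>Function spaces\<close>

definition C_infinity :: "(real \<Rightarrow> real) set" where
  "C_infinity = {f. continuous_on UNIV f \<and> (f \<longlongrightarrow> 0) at_infinity}"

definition C_c_smooth :: "(real \<Rightarrow> real) set" where
  "C_c_smooth = {f. (\<forall>n x. (deriv ^^ n) f field_differentiable (at x)) \<and>
                    compact (closure {x. f x \<noteq> 0})}"

text \<open>The Fourier transform is normalised so that the inversion formula carries no constant.\<close>

definition fourier :: "(real \<Rightarrow> real) \<Rightarrow> real \<Rightarrow> complex" where
  "fourier f \<xi> = complex_of_real (1 / (2 * pi)) *
     (LINT x|lborel. exp (- \<i> * of_real (\<xi> * x)) * of_real (f x))"


section \<open>Markov and Feller processes on the real line\<close>

text \<open>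
  Time is indexed by all reals, but only the values at times \<open>t \<ge> 0\<close> matter. The measure carried by
  \<open>\<Omega>\<close> plays no role: \<open>\<Omega>\<close> is only the measurable space underlying the laws \<open>P x\<close>.
\<close>

definition natural_filtration :: "'w measure \<Rightarrow> (real \<Rightarrow> 'w \<Rightarrow> real) \<Rightarrow> real \<Rightarrow> 'w measure" where
  "natural_filtration \<Omega> X t =
     sigma (space \<Omega>) {X u -` B \<inter> space \<Omega> | u B. 0 \<le> u \<and> u \<le> t \<and> B \<in> sets borel}"

locale markov_process =
  fixes \<Omega> :: "'w measure" and P :: "real \<Rightarrow> 'w measure" and X :: "real \<Rightarrow> 'w \<Rightarrow> real"
  assumes prob_space_P: "\<And>x. prob_space (P x)"
    and sets_P: "\<And>x. sets (P x) = sets \<Omega>"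
    and measurable_X: "\<And>t. 0 \<le> t \<Longrightarrow> X t \<in> borel_measurable \<Omega>"
    and start: "\<And>x. AE \<omega> in P x. X 0 \<omega> = x"
    and measurable_transition: "\<And>t B. 0 \<le> t \<Longrightarrow> B \<in> sets borel \<Longrightarrow>
          (\<lambda>x. emeasure (P x) {\<omega> \<in> space \<Omega>. X t \<omega> \<in> B}) \<in> borel_measurable borel"
    and markov_property: "\<And>x s t A B. 0 \<le> s \<Longrightarrow> 0 \<le> t \<Longrightarrow> B \<in> sets borel \<Longrightarrow>
          A \<in> sets (natural_filtration \<Omega> X s) \<Longrightarrow>
          emeasure (P x) {\<omega> \<in> A. X (s + t) \<omega> \<in> B} =
          (\<integral>\<^sup>+\<omega>\<in>A. emeasure (P (X s \<omega>)) {\<omega>' \<in> space \<Omega>. X t \<omega>' \<in> B} \<partial>P x)"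
begin

definition semigroup :: "real \<Rightarrow> (real \<Rightarrow> real) \<Rightarrow> real \<Rightarrow> real" where
  "semigroup t f x = (LINT \<omega>|P x. f (X t \<omega>))"

definition has_generator_value :: "(real \<Rightarrow> real) \<Rightarrow> (real \<Rightarrow> real) \<Rightarrow> bool" where
  "has_generator_value f g \<longleftrightarrow> f \<in> C_infinity \<and> g \<in> C_infinity \<and>
     uniform_limit UNIV (\<lambda>t x. (semigroup t f x - f x) / t) g (at_right 0)"

definition generator_domain :: "(real \<Rightarrow> real) set" where
  "generator_domain = {f. \<exists>g. has_generator_value f g}"

definition generator :: "(real \<Rightarrow> real) \<Rightarrow> real \<Rightarrow> real" where
  "generator f = (THE g. has_generator_value f g)"

definition irreducible_wrt :: "real measure \<Rightarrow> bool" where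
  "irreducible_wrt \<phi> \<longleftrightarrow> sigma_finite_measure \<phi> \<and> sets \<phi> = sets borel \<and>
     (\<forall>B\<in>sets borel. emeasure \<phi> B > 0 \<longrightarrow>
        (\<forall>x. (\<integral>\<^sup>+t\<in>{0..}. emeasure (P x) {\<omega> \<in> space \<Omega>. X t \<omega> \<in> B} \<partial>lborel) > 0))"

text \<open>In the library, \<open>absolutely_continuous \<psi> \<phi>\<close> reads: \<open>\<phi>\<close> is absolutely continuous
  with respect to \<open>\<psi>\<close>.\<close>

definition maximal_irreducibility_measure :: "real measure \<Rightarrow> bool" where
  "maximal_irreducibility_measure \<psi> \<longleftrightarrow> irreducible_wrt \<psi> \<and>
     (\<forall>\<phi>. sigma_finite_measure \<phi> \<longrightarrow> sets \<phi> = sets borel \<longrightarrow>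
        (irreducible_wrt \<phi> \<longleftrightarrow> absolutely_continuous \<psi> \<phi>))"

end

text \<open>
  The strong Markov property is required for finite stopping times \<open>T\<close> only; applied to
  \<open>min T n\<close> it yields the property on \<open>{T < \<infinity>}\<close> for general ones.
\<close>

locale feller_process = markov_process \<Omega> P X
  for \<Omega> :: "'w measure" and P :: "real \<Rightarrow> 'w measure" and X :: "real \<Rightarrow> 'w \<Rightarrow> real" +
  assumes semigroup_C_infinity: "\<And>t f. 0 \<le> t \<Longrightarrow> f \<in> C_infinity \<Longrightarrow> semigroup t f \<in> C_infinity"
    and strongly_continuous: "\<And>f. f \<in> C_infinity \<Longrightarrow>
          uniform_limit UNIV (\<lambda>t. semigroup t f) f (at_right 0)"
    and right_continuous_paths: "\<And>\<omega> t. \<omega> \<in> space \<Omega> \<Longrightarrow> 0 \<le> t \<Longrightarrow>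
          ((\<lambda>s. X s \<omega>) \<longlongrightarrow> X t \<omega>) (at_right t)"
    and left_limits: "\<And>\<omega> t. \<omega> \<in> space \<Omega> \<Longrightarrow> 0 < t \<Longrightarrow>
          \<exists>l. ((\<lambda>s. X s \<omega>) \<longlongrightarrow> l) (at_left t)"
    and strong_markov_property: "\<And>x T t A B.
          stopping_time (natural_filtration \<Omega> X) T \<Longrightarrow> (\<And>\<omega>. \<omega> \<in> space \<Omega> \<Longrightarrow> 0 \<le> T \<omega>) \<Longrightarrow>
          0 \<le> t \<Longrightarrow> B \<in> sets borel \<Longrightarrow>
          A \<in> sets (filtration.pre_sigma (space \<Omega>) (natural_filtration \<Omega> X) T) \<Longrightarrow>
          emeasure (P x) {\<omega> \<in> A. X (T \<omega> + t) \<omega> \<in> B} =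
          (\<integral>\<^sup>+\<omega>\<in>A. emeasure (P (X (T \<omega>) \<omega>)) {\<omega>' \<in> space \<Omega>. X t \<omega>' \<in> B} \<partial>P x)"


section \<open>Symbols and nice Feller processes\<close>

definition levy_kernel :: "(real \<Rightarrow> real measure) \<Rightarrow> bool" where
  "levy_kernel \<nu> \<longleftrightarrow>
     (\<forall>x. sets (\<nu> x) = sets borel) \<and>
     (\<forall>B\<in>sets borel. (\<lambda>x. emeasure (\<nu> x) B) \<in> borel_measurable borel) \<and>
     (\<forall>x. emeasure (\<nu> x) {0} = 0) \<and>
     (\<forall>x. (\<integral>\<^sup>+y. ennreal (min 1 (y\<^sup>2)) \<partial>\<nu> x) < \<infinity>)"

definition levy_khintchine ::
  "(real \<Rightarrow> real) \<Rightarrow> (real \<Rightarrow> real) \<Rightarrow> (real \<Rightarrow> real) \<Rightarrow> (real \<Rightarrow> real measure) \<Rightarrow> real \<Rightarrow> real \<Rightarrow> complex"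
where
  "levy_khintchine a b c \<nu> x \<xi> =
     of_real (a x) - \<i> * of_real (\<xi> * b x) + of_real (c x * \<xi>\<^sup>2 / 2) -
     (LINT y|\<nu> x. exp (\<i> * of_real (\<xi> * y)) - 1 - \<i> * of_real (\<xi> * y * indicator {-1..1} y))"

locale nice_feller_process = feller_process \<Omega> P X
  for \<Omega> :: "'w measure" and P :: "real \<Rightarrow> 'w measure" and X :: "real \<Rightarrow> 'w \<Rightarrow> real" +
  fixes q :: "real \<Rightarrow> real \<Rightarrow> complex"
    and a b c :: "real \<Rightarrow> real" and \<nu> :: "real \<Rightarrow> real measure"
  assumes C1_domain: "C_c_smooth \<subseteq> generator_domain"
    and C1_symbol: "\<And>f x. f \<in> C_c_smooth \<Longrightarrow> complex_of_real (generator f x) =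
          - (LINT \<xi>|lborel. q x \<xi> * exp (\<i> * of_real (\<xi> * x)) * fourier f \<xi>)"
    and levy_khintchine_repr: "\<And>x \<xi>. q x \<xi> = levy_khintchine a b c \<nu> x \<xi>"
    and coefficients_measurable:
          "a \<in> borel_measurable borel" "b \<in> borel_measurable borel" "c \<in> borel_measurable borel"
    and coefficients_nonneg: "\<And>x. 0 \<le> a x" "\<And>x. 0 \<le> c x"
    and levy_kernel: "levy_kernel \<nu>"
    and C2: "\<exists>C\<ge>0. \<forall>x \<xi>. cmod (q x \<xi>) \<le> C * (1 + \<xi>\<^sup>2)"
    and C3: "\<And>x. q x 0 = 0"
    and C4: "\<exists>\<psi>. maximal_irreducibility_measure \<psi> \<and>
          (\<forall>U. open U \<longrightarrow> U \<noteq> {} \<longrightarrow> emeasure \<psi> U > 0)"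

definition symmetric_symbol :: "(real \<Rightarrow> real \<Rightarrow> complex) \<Rightarrow> bool" where
  "symmetric_symbol q \<longleftrightarrow> (\<forall>x \<xi>. q x \<xi> = of_real (Re (q x \<xi>)))"


section \<open>Tails and quasi-unimodality\<close>

definition symmetric_measure :: "real measure \<Rightarrow> bool" where
  "symmetric_measure \<mu> \<longleftrightarrow> sets \<mu> = sets borel \<and>
     (\<forall>B\<in>sets borel. emeasure \<mu> (uminus ` B) = emeasure \<mu> B)"

definition quasi_unimodal_from :: "real \<Rightarrow> real measure \<Rightarrow> bool" where
  "quasi_unimodal_from y0 \<mu> \<longleftrightarrow> symmetric_measure \<mu> \<and>
     (\<forall>y>y0. emeasure \<mu> {y<..} < \<infinity>) \<and>
     convex_on {y0<..} (\<lambda>y. measure \<mu> {y<..})"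

definition uniformly_quasi_unimodal :: "(real \<Rightarrow> real measure) \<Rightarrow> bool" where
  "uniformly_quasi_unimodal \<nu> \<longleftrightarrow> (\<exists>y0\<ge>0. \<forall>x. quasi_unimodal_from y0 (\<nu> x))"

definition levy_tail :: "(real \<Rightarrow> real measure) \<Rightarrow> real \<Rightarrow> real \<Rightarrow> ennreal" where
  "levy_tail \<nu> x y = emeasure (\<nu> x) {y<..}"

end

theory Submission
  imports Defs
begin

text \<open>
  Write \<open>D(x, r) = \<integral>\<^sub>0\<^sup>r y N(x, y) dy = \<integral>\<^sub>0\<^sup>\<infinity> min(z, r)\<^sup>2/2 \<nu>(x, dz)\<close>. Bounding
  \<open>1 - cos u\<close> by \<open>min 2 (u\<^sup>2/2)\<close> gives \<open>q(x, \<xi>) \<le> c(x) \<xi>\<^sup>2/2 + 2 \<xi>\<^sup>2 D(x, 2/\<xi>)\<close>. Conversely,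
  \<open>1 - cos u \<ge> u\<^sup>2/4\<close> on \<open>[0, \<pi>/2]\<close> controls the jumps below \<open>\<pi>/(2\<xi>)\<close>; for the larger ones
  convexity of the tail says that half-periods on which \<open>cos(\<xi>y) \<le> 0\<close> carry at least as
  much mass as the half-periods following them. Hence \<open>q(x, \<xi>) \<ge> \<xi>\<^sup>2/2 D(x, \<pi>/(2\<xi>))\<close> for small
  \<open>\<xi>\<close>. Taking suprema or infima in \<open>x\<close>, the substitution \<open>r = k/\<xi>\<close> compares the two integrals.
  The diffusion term is harmless: it is dominated by \<open>sup D\<close> in the first part (unless
  \<open>\<nu> = 0\<close>), and absorbed by \<open>inf q / \<xi>\<^sup>2 \<rightarrow> \<infinity>\<close> in the second.
\<close>

section \<open>Integrals and elementary inequalities\<close>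

text \<open>Superlevel sets of a monotone function are intervals. This secures the measurability of
  \<open>S\<close> and \<open>J\<close> below, which are extrema over uncountably many
  \<open>x\<close> but monotone in \<open>r\<close>.\<close>

lemma mono_imp_borel_measurable_ennreal:
  fixes F :: "real \<Rightarrow> ennreal"
  assumes "mono F"
  shows "F \<in> borel_measurable borel"
proof (rule borel_measurableI_greater)
  fix y
  have "is_interval {x. y < F x}"
    unfolding is_interval_1 using monoD[OF assms] by (auto intro: less_le_trans)
  then have "{x. y < F x} \<in> sets borel"
    by (rule real_interval_borel_measurable)
  then show "{x \<in> space borel. y < F x} \<in> sets borel"
    by simp
qed

text \<open>The map \<open>k / \<xi>\<close> is decreasing. Reflecting \<open>r\<close> to
  \<open>- r\<close> first turns it into the increasing map \<open>- k / \<xi>\<close>, whose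
  derivative \<open>k / \<xi>\<^sup>2\<close> is the Jacobian.\<close>

lemma nn_integral_reciprocal_substitution_Icc:
  fixes F :: "real \<Rightarrow> ennreal"
  assumes [measurable]: "F \<in> borel_measurable borel" and "0 < k" "0 < u" "u < s"
  shows "(\<integral>\<^sup>+r\<in>{k / s..k / u}. F r \<partial>lborel) = (\<integral>\<^sup>+\<xi>\<in>{u..s}. F (k / \<xi>) * ennreal (k / \<xi>\<^sup>2) \<partial>lborel)"
proof -
  have "(\<integral>\<^sup>+r\<in>{k / s..k / u}. F r \<partial>lborel) = (\<integral>\<^sup>+r. F (- r) * indicator {- k / u..- k / s} r \<partial>lborel)"
    by (subst nn_integral_real_affine[where c = "-1" and t = 0])
       (auto intro!: nn_integral_cong simp: indicator_def)
  also have "\<dots> = (\<integral>\<^sup>+\<xi>. F (- (- k / \<xi>)) * ennreal (k / \<xi>\<^sup>2) * indicator {u..s} \<xi> \<partial>lborel)"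
  proof (rule nn_integral_substitution_aux)
    show "((\<lambda>\<xi>. - k / \<xi>) has_real_derivative k / \<xi>\<^sup>2) (at \<xi>)" if "\<xi> \<in> {u..s}" for \<xi>
      using that assms by (auto intro!: derivative_eq_intros simp: power2_eq_square)
    show "continuous_on {u..s} (\<lambda>\<xi>. k / \<xi>\<^sup>2)"
      using assms by (auto intro!: continuous_intros)
  qed (use assms in auto)
  finally show ?thesis by simp
qed

lemma nn_integral_reciprocal_substitution:
  fixes F :: "real \<Rightarrow> ennreal"
  assumes [measurable]: "F \<in> borel_measurable borel" and "0 < k" "0 < s"
  shows "(\<integral>\<^sup>+r\<in>{k / s..}. F r \<partial>lborel) = (\<integral>\<^sup>+\<xi>\<in>{0<..s}. F (k / \<xi>) * ennreal (k / \<xi>\<^sup>2) \<partial>lborel)"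
proof -
  \<comment> \<open>Both half-open ranges are exhausted by compact intervals. The offset 2 keeps
    \<open>s / (real n + 2) < s\<close> already for \<open>n = 0\<close>, as the compact case
    demands.\<close>
  define A where "A n = {k / s..k / (s / (real n + 2))}" for n
  define B where "B n = {s / (real n + 2)..s}" for n
  let ?G = "\<lambda>\<xi>. F (k / \<xi>) * ennreal (k / \<xi>\<^sup>2)"
  have A: "(\<Union>n. A n) = {k / s..}"
  proof (intro equalityI subsetI)
    fix r assume r: "r \<in> {k / s..}"
    obtain n where "r * s / k < real n" using reals_Archimedean2 by blast
    then have "r \<in> A n" using r assms by (auto simp: A_def field_simps)
    then show "r \<in> (\<Union>n. A n)" by blast
  qed (auto simp: A_def)
  have B: "(\<Union>n. B n) = {0<..s}"
  proof (intro equalityI subsetI)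
    fix r assume r: "r \<in> {0<..s}"
    obtain n where "s / r < real n" using reals_Archimedean2 by blast
    then have "r \<in> B n" using r assms by (auto simp: B_def field_simps)
    then show "r \<in> (\<Union>n. B n)" by blast
  next
    fix r assume "r \<in> (\<Union>n. B n)"
    then obtain n where n: "s / (real n + 2) \<le> r" "r \<le> s" by (auto simp: B_def)
    have "0 < s / (real n + 2)" using assms by simp
    with n show "r \<in> {0<..s}" by auto
  qed
  have inc: "incseq A" "incseq B"
    using assms by (auto simp: A_def B_def incseq_def frac_le intro!: divide_left_mono mult_left_mono)
  have [measurable]: "A n \<in> sets borel" "B n \<in> sets borel" for n by (auto simp: A_def B_def)
  have "(\<integral>\<^sup>+r\<in>{k / s..}. F r \<partial>lborel) = emeasure (density lborel F) (\<Union>n. A n)"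
    by (simp add: emeasure_density A)
  also have "\<dots> = (SUP n. emeasure (density lborel F) (A n))"
    using inc by (intro SUP_emeasure_incseq[symmetric]) auto
  also have "\<dots> = (SUP n. emeasure (density lborel ?G) (B n))"
  proof (intro SUP_cong refl)
    fix n
    have "s * 1 < s * (real n + 2)" using assms by (intro mult_strict_left_mono) auto
    then have "s / (real n + 2) < s" by (simp add: divide_less_eq)
    then show "emeasure (density lborel F) (A n) = emeasure (density lborel ?G) (B n)"
      using nn_integral_reciprocal_substitution_Icc[of F k "s / (real n + 2)" s] assms
      by (simp add: emeasure_density A_def B_def)
  qed
  also have "\<dots> = emeasure (density lborel ?G) (\<Union>n. B n)"
    using inc by (intro SUP_emeasure_incseq) auto
  also have "\<dots> = (\<integral>\<^sup>+\<xi>\<in>{0<..s}. ?G \<xi> \<partial>lborel)"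
    by (simp add: emeasure_density B)
  finally show ?thesis .
qed

lemma inverse_ennreal_antimono: "x \<le> y \<Longrightarrow> inverse y \<le> inverse x" for x y :: ennreal
  by (simp add: less_eq_ennreal.rep_eq inverse_ennreal.rep_eq ereal_inverse_antimono)

lemma inverse_ennreal_times:
  assumes "0 < k"
  shows "inverse (ennreal k * x) = ennreal (1 / k) * inverse x"
proof (cases x)
  case (real r)
  then show ?thesis using assms
    by (cases "r = 0") (auto simp: ennreal_mult[symmetric] inverse_ennreal ennreal_mult_top field_simps)
qed (use assms in \<open>simp add: ennreal_mult_top\<close>)

lemma one_minus_cos_le: "1 - cos x \<le> x\<^sup>2 / 2" for x :: real
proof -
  have "(sin (x / 2))\<^sup>2 \<le> (x / 2)\<^sup>2"
    using abs_sin_x_le_abs_x[of "x / 2"] by (rule abs_le_square_iff[THEN iffD1])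
  then show ?thesis using cos_double_sin[of "x / 2"] by (simp add: power_divide)
qed

lemma one_minus_cos_ge:
  fixes x :: real
  assumes "0 \<le> x" "x \<le> pi / 2"
  shows "x\<^sup>2 / 4 \<le> 1 - cos x"
proof -
  \<comment> \<open>For \<open>x \<le> 2\<close> the quartic Taylor term \<open>x ^ 4 / 24\<close>
    is at most \<open>x\<^sup>2 / 6\<close>, which leaves \<open>x\<^sup>2 / 3\<close>.\<close>
  have "x \<le> 2" using assms pi_less_4 by linarith
  then have "x\<^sup>2 \<le> 4" using assms power_mono[of x 2 2] by simp
  then have "x\<^sup>2 * x\<^sup>2 \<le> 4 * x\<^sup>2" by (intro mult_right_mono) auto
  moreover have "cos x \<le> 1 - x\<^sup>2 / 2 + x ^ 4 / 24"
  proof -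
    obtain t where t: "cos x = (\<Sum>m<4. cos_coeff m * x ^ m) + cos (t + 1 / 2 * real 4 * pi) / fact 4 * x ^ 4"
      using Maclaurin_cos_expansion[of x 4] by blast
    have "{..<4::nat} = {0, 1, 2, 3}" by auto
    then have sum: "(\<Sum>m<4. cos_coeff m * x ^ m) = 1 - x\<^sup>2 / 2"
      by (simp, simp add: cos_coeff_def)
    have "fact 4 = (24 :: real)" by (simp add: fact_numeral)
    moreover have "cos (t + 1 / 2 * real 4 * pi) * x ^ 4 \<le> 1 * x ^ 4"
      by (intro mult_right_mono cos_le_one) auto
    ultimately show ?thesis unfolding t sum by simp
  qed
  moreover have "x ^ 4 = x\<^sup>2 * x\<^sup>2" using power_add[of x 2 2] by simp
  ultimately show ?thesis using zero_le_power2[of x] by linarith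
qed

section \<open>Symmetric Levy measures\<close>

text \<open>For \<open>\<mu> = \<nu> x\<close> this is \<open>D(x, r)\<close>: by
  \<open>tail_moment_eq\<close>, half the second moment of the positive jumps, each capped at
  \<open>r\<close>.\<close>

definition tail_moment :: "real measure \<Rightarrow> real \<Rightarrow> ennreal" where
  "tail_moment \<mu> r = (\<integral>\<^sup>+y\<in>{0..r}. ennreal y * emeasure \<mu> {y<..} \<partial>lborel)"

lemma tail_moment_mono: "r \<le> s \<Longrightarrow> tail_moment \<mu> r \<le> tail_moment \<mu> s"
  unfolding tail_moment_def by (intro nn_integral_mono) (auto simp: indicator_def)

locale symmetric_levy_measure =
  fixes \<mu> :: "real measure"
  assumes sets_eq [simp, measurable_cong]: "sets \<mu> = sets borel"
    and zero_null: "emeasure \<mu> {0} = 0"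
    and finite_second_moment: "(\<integral>\<^sup>+y. ennreal (min 1 (y\<^sup>2)) \<partial>\<mu>) < \<infinity>"
    and symmetric: "\<And>B. B \<in> sets borel \<Longrightarrow> emeasure \<mu> (uminus ` B) = emeasure \<mu> B"
begin

lemma space_eq [simp]: "space \<mu> = UNIV"
  using sets_eq_imp_space_eq[OF sets_eq] by simp

text \<open>Markov's inequality bounds the measure of each set where
  \<open>min 1 (y\<^sup>2)\<close> exceeds a positive level, and these sets cover everything except
  the null set \<open>{0}\<close>. The Fubini step of \<open>tail_moment_eq\<close> rests on
  this.\<close>

lemma sigma_finite: "sigma_finite_measure \<mu>"
proof
  define S where "S n = {y::real. 1 / (real n + 1) \<le> min 1 (y\<^sup>2)}" for n
  have meas [measurable]: "S n \<in> sets borel" for n unfolding S_def by measurable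
  have "emeasure \<mu> (S n) \<noteq> \<infinity>" for n
  proof -
    have "ennreal (1 / (real n + 1)) * emeasure \<mu> (S n) = (\<integral>\<^sup>+y. ennreal (1 / (real n + 1)) * indicator (S n) y \<partial>\<mu>)"
      by (simp add: nn_integral_cmult_indicator)
    also have "\<dots> \<le> (\<integral>\<^sup>+y. ennreal (min 1 (y\<^sup>2)) \<partial>\<mu>)"
      by (intro nn_integral_mono) (auto simp: S_def indicator_def intro!: ennreal_leI)
    finally have "ennreal (1 / (real n + 1)) * emeasure \<mu> (S n) < \<infinity>"
      using finite_second_moment by (rule le_less_trans)
    then show ?thesis
      by (auto simp: ennreal_mult_less_top add_nonneg_pos)
  qed
  moreover have "\<Union> (insert {0} (range S)) = UNIV"
  proof -
    have "y \<in> (\<Union>n. S n)" if "y \<noteq> 0" for y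
    proof -
      obtain n where "1 / (y\<^sup>2) < real n" using reals_Archimedean2 by blast
      with that have "1 < real n * y\<^sup>2" by (simp add: divide_less_eq)
      also have "\<dots> \<le> y\<^sup>2 * (real n + 1)" by (simp add: algebra_simps)
      finally have "y \<in> S n" by (simp add: S_def divide_le_eq add_nonneg_pos)
      then show ?thesis by blast
    qed
    then show ?thesis by auto
  qed
  ultimately show "\<exists>A. countable A \<and> A \<subseteq> sets \<mu> \<and> \<Union> A = space \<mu> \<and> (\<forall>a\<in>A. emeasure \<mu> a \<noteq> \<infinity>)"
    using zero_null by (intro exI[of _ "insert {0} (range S)"]) auto
qed

text \<open>The tail is the integral of the indicator of \<open>y < z\<close>. By Tonelli,
  \<open>y\<close> may be integrated first, over \<open>{0..min z r}\<close> up to the single point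
  \<open>y = z\<close>.\<close>

lemma tail_moment_eq:
  assumes "0 \<le> r"
  shows "tail_moment \<mu> r = (\<integral>\<^sup>+z\<in>{0<..}. ennreal ((min z r)\<^sup>2 / 2) \<partial>\<mu>)"
proof -
  interpret \<mu>: sigma_finite_measure \<mu> by (rule sigma_finite)
  interpret pair_sigma_finite \<mu> lborel ..
  define f where "f y z = ennreal y * indicator {0..r} y * (if y < z then 1 else 0)" for y z :: real
  have [measurable]: "(\<lambda>(z, y). f y z) \<in> borel_measurable (\<mu> \<Otimes>\<^sub>M lborel)"
    unfolding f_def by measurable
  have "tail_moment \<mu> r = (\<integral>\<^sup>+y. \<integral>\<^sup>+z. f y z \<partial>\<mu> \<partial>lborel)"
    unfolding tail_moment_def
  proof (intro nn_integral_cong)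
    fix y
    have "(\<integral>\<^sup>+z. f y z \<partial>\<mu>) = (\<integral>\<^sup>+z. ennreal y * indicator {0..r} y * indicator {y<..} z \<partial>\<mu>)"
      by (intro nn_integral_cong) (auto simp: f_def indicator_def)
    also have "\<dots> = ennreal y * indicator {0..r} y * emeasure \<mu> {y<..}"
      by (rule nn_integral_cmult_indicator) simp
    finally show "ennreal y * emeasure \<mu> {y<..} * indicator {0..r} y = (\<integral>\<^sup>+z. f y z \<partial>\<mu>)"
      by (simp add: mult_ac)
  qed
  also have "\<dots> = (\<integral>\<^sup>+z. \<integral>\<^sup>+y. f y z \<partial>lborel \<partial>\<mu>)"
    by (rule Fubini') measurable
  also have "\<dots> = (\<integral>\<^sup>+z\<in>{0<..}. ennreal ((min z r)\<^sup>2 / 2) \<partial>\<mu>)"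
  proof (intro nn_integral_cong)
    fix z
    show "(\<integral>\<^sup>+y. f y z \<partial>lborel) = ennreal ((min z r)\<^sup>2 / 2) * indicator {0<..} z"
    proof (cases "0 < z")
      case True
      have "(\<integral>\<^sup>+y. f y z \<partial>lborel) = (\<integral>\<^sup>+y. ennreal y * indicator {0..min z r} y \<partial>lborel)"
        by (intro nn_integral_cong_AE eventually_mono[OF AE_lborel_singleton[of z]])
           (auto simp: f_def indicator_def)
      also have "\<dots> = ennreal ((min z r)\<^sup>2 / 2) - ennreal (0\<^sup>2 / 2)"
        using True assms
        by (subst nn_integral_FTC_Icc[where F = "\<lambda>y. y\<^sup>2 / 2"])
           (auto intro!: derivative_eq_intros)
      finally show ?thesis using True by simp
    next
      case False
      then have "f y z = 0" for y by (auto simp: f_def indicator_def)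
      then show ?thesis using False by simp
    qed
  qed
  finally show ?thesis .
qed

text \<open>Capping satisfies \<open>min z r \<le> r / \<rho> * min z \<rho>\<close>, so the growth
  is at most quadratic. In particular, a zero at \<open>\<rho>\<close> persists for all larger
  \<open>r\<close>.\<close>

lemma tail_moment_scale:
  assumes "0 < \<rho>" "\<rho> \<le> r"
  shows "tail_moment \<mu> r \<le> ennreal ((r / \<rho>)\<^sup>2) * tail_moment \<mu> \<rho>"
proof -
  have *: "(min z r)\<^sup>2 / 2 \<le> (r / \<rho>)\<^sup>2 * ((min z \<rho>)\<^sup>2 / 2)" if "0 < z" for z
  proof -
    have "min z r \<le> r / \<rho> * min z \<rho>"
    proof (cases "z \<le> \<rho>")
      case True
      have "1 * z \<le> r / \<rho> * z" using assms that by (intro mult_right_mono) auto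
      with True show ?thesis by simp
    qed (use assms in simp)
    then have "(min z r)\<^sup>2 \<le> (r / \<rho> * min z \<rho>)\<^sup>2"
      using assms that by (intro power_mono) auto
    then show ?thesis unfolding power_mult_distrib by simp
  qed
  have "tail_moment \<mu> r \<le> (\<integral>\<^sup>+z. ennreal ((r / \<rho>)\<^sup>2) * (ennreal ((min z \<rho>)\<^sup>2 / 2) * indicator {0<..} z) \<partial>\<mu>)"
    using assms * by (auto simp: tail_moment_eq indicator_def ennreal_mult[symmetric] intro!: nn_integral_mono ennreal_leI)
  also have "\<dots> = ennreal ((r / \<rho>)\<^sup>2) * tail_moment \<mu> \<rho>"
    using assms by (simp add: tail_moment_eq nn_integral_cmult)
  finally show ?thesis .
qed

lemma nn_integral_even:
  assumes [measurable]: "f \<in> borel_measurable borel"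
    and even: "\<And>z. f (- z) = f z" and zero: "f 0 = 0"
  shows "(\<integral>\<^sup>+z. f z \<partial>\<mu>) = 2 * (\<integral>\<^sup>+z\<in>{0<..}. f z \<partial>\<mu>)"
proof -
  have distr: "distr \<mu> borel uminus = \<mu>"
  proof (rule measure_eqI)
    fix B assume "B \<in> sets (distr \<mu> borel uminus)"
    then have B: "B \<in> sets borel" by simp
    have "uminus -` B = uminus ` B" by (force simp: image_iff)
    then show "emeasure (distr \<mu> borel uminus) B = emeasure \<mu> B"
      using B symmetric[OF B] by (simp add: emeasure_distr)
  qed simp
  have "(\<integral>\<^sup>+z. f z \<partial>\<mu>) = (\<integral>\<^sup>+z. f z * indicator {0<..} z + f z * indicator {..<0} z \<partial>\<mu>)"
    by (intro nn_integral_cong) (auto simp: indicator_def zero not_less le_less)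
  also have "\<dots> = (\<integral>\<^sup>+z\<in>{0<..}. f z \<partial>\<mu>) + (\<integral>\<^sup>+z\<in>{..<0}. f z \<partial>\<mu>)"
    by (rule nn_integral_add) auto
  also have "(\<integral>\<^sup>+z\<in>{..<0}. f z \<partial>\<mu>) = (\<integral>\<^sup>+z\<in>{..<0}. f z \<partial>distr \<mu> borel uminus)"
    by (simp add: distr)
  also have "\<dots> = (\<integral>\<^sup>+z\<in>{0<..}. f z \<partial>\<mu>)"
    by (subst nn_integral_distr) (auto intro!: nn_integral_cong simp: even indicator_def)
  finally show ?thesis by (simp add: mult_2)
qed

text \<open>The cut-off \<open>2 / \<xi>\<close> is the point where the two bounds
  \<open>(\<xi> * z)\<^sup>2 / 2\<close> and 2 for \<open>1 - cos (\<xi> * z)\<close> meet.\<close>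

lemma nn_integral_one_minus_cos_le:
  assumes "0 < \<xi>"
  shows "(\<integral>\<^sup>+z\<in>{0<..}. ennreal (1 - cos (\<xi> * z)) \<partial>\<mu>) \<le> ennreal (\<xi>\<^sup>2) * tail_moment \<mu> (2 / \<xi>)"
proof -
  have *: "1 - cos (\<xi> * z) \<le> \<xi>\<^sup>2 * ((min z (2 / \<xi>))\<^sup>2 / 2)" for z
  proof (cases "z \<le> 2 / \<xi>")
    case True
    then show ?thesis using one_minus_cos_le[of "\<xi> * z"] by (simp add: power_mult_distrib)
  next
    case False
    have "1 - cos (\<xi> * z) \<le> 2" using cos_ge_minus_one[of "\<xi> * z"] by linarith
    with False assms show ?thesis by (simp add: power_divide)
  qed
  have "(\<integral>\<^sup>+z\<in>{0<..}. ennreal (1 - cos (\<xi> * z)) \<partial>\<mu>)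
      \<le> (\<integral>\<^sup>+z. ennreal (\<xi>\<^sup>2) * (ennreal ((min z (2 / \<xi>))\<^sup>2 / 2) * indicator {0<..} z) \<partial>\<mu>)"
    using * by (intro nn_integral_mono) (auto simp: indicator_def ennreal_mult[symmetric] intro!: ennreal_leI)
  also have "\<dots> = ennreal (\<xi>\<^sup>2) * tail_moment \<mu> (2 / \<xi>)"
    using assms by (simp add: tail_moment_eq nn_integral_cmult)
  finally show ?thesis .
qed

text \<open>On \<open>{-1..1}\<close> the compensated integrand is of second order, at most
  \<open>(\<xi> * y)\<^sup>2 / 2\<close>; elsewhere it is at most 2. The factor
  \<open>2 + \<xi>\<^sup>2\<close> covers both. Integrability lets the real part pass under the
  integral.\<close>

lemma integrable_levy_khintchine:
  "integrable \<mu> (\<lambda>y. exp (\<i> * of_real (\<xi> * y)) - 1 - \<i> * of_real (\<xi> * y * indicator {-1..1} y))"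
    (is "integrable \<mu> ?g")
proof (rule Bochner_Integration.integrable_bound)
  show "integrable \<mu> (\<lambda>y. (2 + \<xi>\<^sup>2) * min 1 (y\<^sup>2))"
    using finite_second_moment by (intro integrable_mult_right integrableI_nonneg) auto
  have "cmod (?g y) \<le> (2 + \<xi>\<^sup>2) * min 1 (y\<^sup>2)" for y
  proof (cases "y \<in> {-1..1}")
    case True
    then have "y\<^sup>2 \<le> 1" by (simp add: abs_square_le_1 abs_le_iff)
    have "cmod (?g y) \<le> (\<xi> * y)\<^sup>2 / 2"
      using iexp_approx1[of "\<xi> * y" 1] True by (simp add: numeral_eq_Suc diff_diff_eq)
    also have "\<dots> \<le> (2 + \<xi>\<^sup>2) * y\<^sup>2" by (simp add: power_mult_distrib algebra_simps)
    finally show ?thesis using \<open>y\<^sup>2 \<le> 1\<close> by simp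
  next
    case False
    then have "1 \<le> \<bar>y\<bar>" by auto
    then have "1 \<le> y\<^sup>2" using one_le_power[of "\<bar>y\<bar>" 2] by simp
    have "cmod (?g y) \<le> cmod (exp (\<i> * of_real (\<xi> * y))) + 1"
      using False norm_triangle_ineq4[of "exp (\<i> * of_real (\<xi> * y))" 1] by simp
    also have "\<dots> \<le> 2 + \<xi>\<^sup>2" using norm_exp_i_times[of "\<xi> * y"] by simp
    finally show ?thesis using \<open>1 \<le> y\<^sup>2\<close> by simp
  qed
  then show "AE y in \<mu>. norm (?g y) \<le> norm ((2 + \<xi>\<^sup>2) * min 1 (y\<^sup>2))"
    by (intro AE_I2) (auto simp: abs_mult intro: order_trans)
qed auto

text \<open>Drift and compensator are purely imaginary, so only \<open>a\<close>, \<open>c\<close>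
  and the cosine integral survive in the real part. Symmetry folds that integral onto the positive
  half-line, whence the factor 2.\<close>

lemma ennreal_Re_levy_khintchine:
  assumes "\<nu> x = \<mu>" "0 \<le> a x" "0 \<le> c x"
  shows "ennreal (Re (levy_khintchine a b c \<nu> x \<xi>)) =
    ennreal (a x + c x * \<xi>\<^sup>2 / 2) + 2 * (\<integral>\<^sup>+z\<in>{0<..}. ennreal (1 - cos (\<xi> * z)) \<partial>\<mu>)"
    and "0 \<le> Re (levy_khintchine a b c \<nu> x \<xi>)"
proof -
  let ?g = "\<lambda>y. exp (\<i> * of_real (\<xi> * y)) - 1 - \<i> * of_real (\<xi> * y * indicator {-1..1} y)"
  have Re_g: "Re (?g y) = - (1 - cos (\<xi> * y))" for y
    by (simp add: Re_exp)
  have int: "integrable \<mu> (\<lambda>y. 1 - cos (\<xi> * y))"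
    using integrable_minus[OF integrable_Re[OF integrable_levy_khintchine[of \<xi>]]]
    unfolding Re_g by simp
  have "Re (LINT y|\<mu>. ?g y) = (LINT y|\<mu>. Re (?g y))"
    by (rule integral_Re[OF integrable_levy_khintchine, symmetric])
  then have Re_int: "Re (LINT y|\<mu>. ?g y) = - (LINT y|\<mu>. 1 - cos (\<xi> * y))"
    unfolding Re_g Bochner_Integration.integral_minus .
  have eq: "Re (levy_khintchine a b c \<nu> x \<xi>) = a x + c x * \<xi>\<^sup>2 / 2 + (LINT y|\<mu>. 1 - cos (\<xi> * y))"
    unfolding levy_khintchine_def assms(1) minus_complex.sel plus_complex.sel Re_int by simp
  have nonneg: "0 \<le> (LINT y|\<mu>. 1 - cos (\<xi> * y))" by (intro integral_nonneg_AE) auto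
  show "0 \<le> Re (levy_khintchine a b c \<nu> x \<xi>)"
    using assms nonneg unfolding eq by simp
  have "ennreal (LINT y|\<mu>. 1 - cos (\<xi> * y)) = (\<integral>\<^sup>+y. ennreal (1 - cos (\<xi> * y)) \<partial>\<mu>)"
    using int by (intro nn_integral_eq_integral[symmetric]) auto
  also have "\<dots> = 2 * (\<integral>\<^sup>+z\<in>{0<..}. ennreal (1 - cos (\<xi> * z)) \<partial>\<mu>)"
    by (rule nn_integral_even) auto
  finally show "ennreal (Re (levy_khintchine a b c \<nu> x \<xi>)) =
    ennreal (a x + c x * \<xi>\<^sup>2 / 2) + 2 * (\<integral>\<^sup>+z\<in>{0<..}. ennreal (1 - cos (\<xi> * z)) \<partial>\<mu>)"
    unfolding eq using assms nonneg by (subst ennreal_plus) auto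
qed

end

section \<open>Levy measures with an eventually convex tail\<close>

locale quasi_unimodal_levy_measure = symmetric_levy_measure +
  fixes y0 :: real
  assumes nonneg: "0 \<le> y0"
    and finite_tail: "\<And>y. y0 < y \<Longrightarrow> emeasure \<mu> {y<..} < \<infinity>"
    and convex_tail: "convex_on {y0<..} (\<lambda>y. measure \<mu> {y<..})"
begin

text \<open>This is midpoint convexity of the tail at \<open>y + l\<close>, between \<open>y\<close>
  and \<open>y + 2 * l\<close>, rewritten with differences of tails as interval masses.\<close>

lemma emeasure_Ioc_shift_le:
  assumes "y0 < y" "0 \<le> l"
  shows "emeasure \<mu> {y + l<..y + 2 * l} \<le> emeasure \<mu> {y<..y + l}"
proof -
  let ?N = "\<lambda>y. measure \<mu> {y<..}"
  have Ioc: "emeasure \<mu> {u<..u + l} = ennreal (?N u - ?N (u + l))" if "y0 < u" for u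
  proof -
    have "{u<..u + l} = {u<..} - {u + l<..}" by auto
    moreover have "measure \<mu> ({u<..} - {u + l<..}) = ?N u - ?N (u + l)"
      using finite_tail[of u] that assms by (intro measure_Diff) auto
    ultimately show ?thesis
      using finite_tail[of u] finite_tail[of "u + l"] that assms
      by (simp add: emeasure_Diff emeasure_eq_ennreal_measure ennreal_minus less_top[symmetric])
  qed
  have "?N ((1 - 1 / 2) *\<^sub>R y + (1 / 2) *\<^sub>R (y + 2 * l)) \<le> (1 - 1 / 2) * ?N y + (1 / 2) * ?N (y + 2 * l)"
    using assms by (intro convex_onD[OF convex_tail]) auto
  then have "?N (y + l) - ?N (y + l + l) \<le> ?N y - ?N (y + l)"
    by (simp add: algebra_simps)
  then show ?thesis
    using Ioc[of y] Ioc[of "y + l"] assms by (simp add: ennreal_leI add.assoc)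
qed

text \<open>
  The half-line is cut into half-periods of the cosine, \<open>G j\<close> (where it is nonpositive) followed
  by \<open>B j\<close>; convexity makes the mass of \<open>B j\<close> at most that of \<open>G j\<close>.
\<close>

lemma tail_le_nn_integral_one_minus_cos:
  assumes "0 < \<xi>" "y0 < y" and phase: "\<xi> * y = pi / 2 + 2 * pi * real k"
  shows "emeasure \<mu> {y<..} \<le> 2 * (\<integral>\<^sup>+z\<in>{y<..}. ennreal (1 - cos (\<xi> * z)) \<partial>\<mu>)"
proof -
  define l where "l = pi / \<xi>"
  have l: "0 < l" using assms by (simp add: l_def)
  define G where "G j = {y + 2 * real j * l<..y + 2 * real j * l + l}" for j :: nat
  define B where "B j = {y + 2 * real j * l + l<..y + 2 * real j * l + 2 * l}" for j :: nat
  have [measurable]: "G j \<in> sets borel" "B j \<in> sets borel" for j by (auto simp: G_def B_def)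
  have cover: "{y<..} \<subseteq> (\<Union>j. G j) \<union> (\<Union>j. B j)"
  proof
    fix z assume z: "z \<in> {y<..}"
    \<comment> \<open>The index of the half-period containing \<open>z\<close>. The pieces are open
      on the left and closed on the right, hence the ceiling minus one; the parity of
      \<open>m\<close> selects \<open>G\<close> or \<open>B\<close>.\<close>
    define m where "m = nat (\<lceil>(z - y) / l\<rceil> - 1)"
    have "1 \<le> \<lceil>(z - y) / l\<rceil>" using z l by (simp add: le_ceiling_iff)
    then have "real m = of_int \<lceil>(z - y) / l\<rceil> - 1" by (simp add: m_def of_nat_nat)
    then have "real m < (z - y) / l" "(z - y) / l \<le> real m + 1"
      using ceiling_correct[of "(z - y) / l"] by auto
    then have m: "y + real m * l < z" "z \<le> y + real m * l + l"
      using l by (auto simp: field_simps)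
    show "z \<in> (\<Union>j. G j) \<union> (\<Union>j. B j)"
    proof (cases "even m")
      case True
      then obtain j where "m = 2 * j" by (elim evenE)
      with m have "z \<in> G j" by (simp add: G_def algebra_simps)
      then show ?thesis by blast
    next
      case False
      then obtain j where "m = 2 * j + 1" by (elim oddE)
      with m have "z \<in> B j" by (simp add: B_def algebra_simps)
      then show ?thesis by blast
    qed
  qed
  have G_cos: "y < z \<and> cos (\<xi> * z) \<le> 0" if zG: "z \<in> G j" for j z
  proof
    have "0 \<le> 2 * real j * l" using l by simp
    moreover have "y + 2 * real j * l < z" using zG by (simp add: G_def)
    ultimately show "y < z" by linarith
    \<comment> \<open>The phase elapsed since the left end of \<open>G j\<close>. It lies in
      \<open>{0..pi}\<close>, and a shift of the sine by a quarter period makes the cosine equal to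
      \<open>- sin t\<close>.\<close>
    define t where "t = \<xi> * (z - y - 2 * real j * l)"
    have "\<xi> * l = pi" using assms(1) by (simp add: l_def)
    have "0 \<le> t" "t \<le> \<xi> * l"
      unfolding t_def using zG assms(1) by (auto simp: G_def intro!: mult_left_mono mult_nonneg_nonneg)
    then have "t \<le> pi" unfolding \<open>\<xi> * l = pi\<close> by simp
    then have "\<xi> * z = (pi / 2 + t) + 2 * real (k + j) * pi"
      using phase \<open>\<xi> * l = pi\<close> by (simp add: t_def algebra_simps)
    then have "cos (\<xi> * z) = - sin t"
      by (simp only: cos_add cos_2npi sin_2npi) simp
    with \<open>0 \<le> t\<close> \<open>t \<le> pi\<close> show "cos (\<xi> * z) \<le> 0" by (simp add: sin_ge_zero)
  qed
  have disj: "disjoint_family G"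
    unfolding disjoint_family_on_def
  proof (intro ballI impI)
    fix i j :: nat assume "i \<noteq> j"
    have "G i \<inter> G j = {}" if "i < j" for i j
    proof -
      have "2 * real i * l + l \<le> 2 * real j * l"
        using mult_right_mono[of "2 * real i + 1" "2 * real j" l] that l by (simp add: algebra_simps)
      then show ?thesis by (auto simp: G_def)
    qed
    with \<open>i \<noteq> j\<close> show "G i \<inter> G j = {}" by (metis inf_commute linorder_neqE_nat)
  qed
  have "emeasure \<mu> {y<..} \<le> emeasure \<mu> ((\<Union>j. G j) \<union> (\<Union>j. B j))"
    using cover by (intro emeasure_mono) auto
  also have "\<dots> \<le> emeasure \<mu> (\<Union>j. G j) + emeasure \<mu> (\<Union>j. B j)"
    by (intro emeasure_subadditive) auto
  also have "emeasure \<mu> (\<Union>j. B j) \<le> (\<Sum>j. emeasure \<mu> (B j))"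
    by (intro emeasure_subadditive_countably) auto
  also have "\<dots> \<le> (\<Sum>j. emeasure \<mu> (G j))"
  proof (intro suminf_le allI)
    fix j :: nat
    have "0 \<le> 2 * real j * l" using l by simp
    then have "y0 < y + 2 * real j * l" using assms(2) by linarith
    then show "emeasure \<mu> (B j) \<le> emeasure \<mu> (G j)"
      unfolding B_def G_def using l by (intro emeasure_Ioc_shift_le) auto
  qed auto
  also have "\<dots> = emeasure \<mu> (\<Union>j. G j)"
    using disj by (intro suminf_emeasure) auto
  finally have "emeasure \<mu> {y<..} \<le> 2 * emeasure \<mu> (\<Union>j. G j)"
    by (simp add: mult_2 add_left_mono)
  also have "emeasure \<mu> (\<Union>j. G j) = (\<integral>\<^sup>+z. indicator (\<Union>j. G j) z \<partial>\<mu>)"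
    by simp
  also have "\<dots> \<le> (\<integral>\<^sup>+z\<in>{y<..}. ennreal (1 - cos (\<xi> * z)) \<partial>\<mu>)"
    using G_cos by (intro nn_integral_mono) (auto simp: indicator_def)
  finally show ?thesis by (simp add: mult_left_mono)
qed

text \<open>The split point is the quarter period \<open>A\<close>, where
  \<open>\<xi> * A = pi / 2\<close>. Below it the quadratic bound applies. Above it the capped
  integrand is constant, equal to \<open>(pi / 4)\<^sup>2 \<le> 1\<close>, so the tail mass at
  \<open>A\<close> dominates it and the half-period argument with \<open>k = 0\<close> takes
  over.\<close>

lemma nn_integral_one_minus_cos_ge:
  assumes "0 < \<xi>" "y0 < pi / (2 * \<xi>)"
  shows "ennreal (\<xi>\<^sup>2 / 2) * tail_moment \<mu> (pi / (2 * \<xi>))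
    \<le> 2 * (\<integral>\<^sup>+z\<in>{0<..}. ennreal (1 - cos (\<xi> * z)) \<partial>\<mu>)"
proof -
  define A where "A = pi / (2 * \<xi>)"
  have A: "0 < A" "\<xi> * A = pi / 2" using assms by (auto simp: A_def)
  let ?f = "\<lambda>z. ennreal (1 - cos (\<xi> * z))"
  have pointwise: "ennreal (\<xi>\<^sup>2 / 2) * (ennreal ((min z A)\<^sup>2 / 2) * indicator {0<..} z)
      \<le> ?f z * indicator {0<..A} z + indicator {A<..} z" for z
  proof -
    consider "z \<le> 0" | "0 < z" "z \<le> A" | "A < z" by linarith
    then show ?thesis
    proof cases
      case 2
      then have "\<xi> * z \<le> \<xi> * A" using assms(1) by (intro mult_left_mono) auto
      then have "\<xi> * z \<le> pi / 2" unfolding A(2) .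
      then have "(\<xi> * z)\<^sup>2 / 4 \<le> 1 - cos (\<xi> * z)"
        using 2 assms(1) by (intro one_minus_cos_ge) auto
      then show ?thesis using 2
        by (auto simp: ennreal_mult[symmetric] power_mult_distrib intro!: ennreal_leI)
    next
      case 3
      have "\<xi>\<^sup>2 / 2 * (A\<^sup>2 / 2) = (\<xi> * A)\<^sup>2 / 4" by (simp add: power_mult_distrib)
      also have "\<dots> = (pi / 4)\<^sup>2" unfolding A(2) by (simp add: power_divide)
      also have "\<dots> \<le> 1" using pi_less_4 by (intro power_le_one) auto
      finally show ?thesis using 3 A
        by (auto simp: ennreal_mult[symmetric] min_def ennreal_leI simp flip: ennreal_1)
    qed simp
  qed
  have "ennreal (\<xi>\<^sup>2 / 2) * tail_moment \<mu> A
      = (\<integral>\<^sup>+z. ennreal (\<xi>\<^sup>2 / 2) * (ennreal ((min z A)\<^sup>2 / 2) * indicator {0<..} z) \<partial>\<mu>)"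
    using A by (simp add: tail_moment_eq nn_integral_cmult)
  also have "\<dots> \<le> (\<integral>\<^sup>+z. ?f z * indicator {0<..A} z + indicator {A<..} z \<partial>\<mu>)"
    by (intro nn_integral_mono pointwise)
  also have "\<dots> = (\<integral>\<^sup>+z\<in>{0<..A}. ?f z \<partial>\<mu>) + emeasure \<mu> {A<..}"
    by (subst nn_integral_add) auto
  also have "\<dots> \<le> 2 * (\<integral>\<^sup>+z\<in>{0<..A}. ?f z \<partial>\<mu>) + 2 * (\<integral>\<^sup>+z\<in>{A<..}. ?f z \<partial>\<mu>)"
  proof (intro add_mono)
    show "emeasure \<mu> {A<..} \<le> 2 * (\<integral>\<^sup>+z\<in>{A<..}. ?f z \<partial>\<mu>)"
      using assms A by (intro tail_le_nn_integral_one_minus_cos[of _ _ 0]) (auto simp: A_def)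
  qed (simp add: mult_2)
  also have "\<dots> = 2 * (\<integral>\<^sup>+z. ?f z * indicator {0<..A} z + ?f z * indicator {A<..} z \<partial>\<mu>)"
    by (subst nn_integral_add) (auto simp: distrib_left)
  also have "(\<integral>\<^sup>+z. ?f z * indicator {0<..A} z + ?f z * indicator {A<..} z \<partial>\<mu>) = (\<integral>\<^sup>+z\<in>{0<..}. ?f z \<partial>\<mu>)"
    using A by (intro nn_integral_cong) (auto simp: indicator_def)
  finally show ?thesis by (simp add: A_def)
qed

end

section \<open>Integrals near frequency zero versus integrals near infinity\<close>

text \<open>Since \<open>1 / (m * \<xi>\<^sup>2)\<close> is the Jacobian
  \<open>k / \<xi>\<^sup>2\<close> divided by \<open>m * k\<close>, the substitution
  \<open>r = k / \<xi>\<close> absorbs the weight \<open>\<xi>\<^sup>2\<close> exactly.\<close>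

lemma nn_integral_reciprocal_inverse:
  fixes G :: "real \<Rightarrow> ennreal"
  assumes [measurable]: "G \<in> borel_measurable borel" and "0 < k" "0 < m" "0 < s"
  shows "(\<integral>\<^sup>+\<xi>\<in>{0<..s}. inverse (ennreal (m * \<xi>\<^sup>2) * G (k / \<xi>)) \<partial>lborel) =
    ennreal (1 / (m * k)) * (\<integral>\<^sup>+r\<in>{k / s..}. inverse (G r) \<partial>lborel)"
proof -
  have "(\<integral>\<^sup>+\<xi>\<in>{0<..s}. inverse (ennreal (m * \<xi>\<^sup>2) * G (k / \<xi>)) \<partial>lborel)
      = (\<integral>\<^sup>+\<xi>. ennreal (1 / (m * k)) * (inverse (G (k / \<xi>)) * ennreal (k / \<xi>\<^sup>2) * indicator {0<..s} \<xi>) \<partial>lborel)"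
  proof (intro nn_integral_cong)
    fix \<xi>
    show "inverse (ennreal (m * \<xi>\<^sup>2) * G (k / \<xi>)) * indicator {0<..s} \<xi>
      = ennreal (1 / (m * k)) * (inverse (G (k / \<xi>)) * ennreal (k / \<xi>\<^sup>2) * indicator {0<..s} \<xi>)"
    proof (cases "\<xi> \<in> {0<..s}")
      case True
      have "ennreal (1 / (m * \<xi>\<^sup>2)) = ennreal (1 / (m * k)) * ennreal (k / \<xi>\<^sup>2)"
        using True assms by (simp add: ennreal_mult[symmetric])
      moreover have "inverse (ennreal (m * \<xi>\<^sup>2) * G (k / \<xi>)) = ennreal (1 / (m * \<xi>\<^sup>2)) * inverse (G (k / \<xi>))"
        using True assms by (intro inverse_ennreal_times) auto
      ultimately show ?thesis by (simp add: mult_ac)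
    qed simp
  qed
  also have "\<dots> = ennreal (1 / (m * k)) * (\<integral>\<^sup>+\<xi>\<in>{0<..s}. inverse (G (k / \<xi>)) * ennreal (k / \<xi>\<^sup>2) \<partial>lborel)"
    by (rule nn_integral_cmult) measurable
  also have "(\<integral>\<^sup>+\<xi>\<in>{0<..s}. inverse (G (k / \<xi>)) * ennreal (k / \<xi>\<^sup>2) \<partial>lborel) = (\<integral>\<^sup>+r\<in>{k / s..}. inverse (G r) \<partial>lborel)"
    using assms by (intro nn_integral_reciprocal_substitution[symmetric]) auto
  finally show ?thesis .
qed

text \<open>The measurable majorant \<open>h\<close> carries the estimate: \<open>f\<close> will be
  the reciprocal of an extremum over uncountably many \<open>x\<close>, whose measurability is not
  established here.\<close>

lemma nn_integral_symmetric_interval_le: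
  fixes f h :: "real \<Rightarrow> ennreal"
  assumes [measurable]: "h \<in> borel_measurable borel"
    and le: "\<And>\<xi>. 0 < \<xi> \<Longrightarrow> \<xi> < s \<Longrightarrow> f \<xi> \<le> h \<xi>"
    and even: "\<And>\<xi>. f (- \<xi>) = f \<xi>"
  shows "(\<integral>\<^sup>+\<xi>\<in>{\<xi>. \<bar>\<xi>\<bar> < s}. f \<xi> \<partial>lborel) \<le> 2 * (\<integral>\<^sup>+\<xi>\<in>{0<..s}. h \<xi> \<partial>lborel)"
proof -
  let ?h = "\<lambda>\<xi>. h \<xi> * indicator {0<..s} \<xi>"
  have "(\<integral>\<^sup>+\<xi>\<in>{\<xi>. \<bar>\<xi>\<bar> < s}. f \<xi> \<partial>lborel) \<le> (\<integral>\<^sup>+\<xi>. ?h \<xi> + ?h (- \<xi>) \<partial>lborel)"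
  proof (intro nn_integral_mono_AE eventually_mono[OF AE_lborel_singleton[of 0]])
    fix \<xi> :: real assume "\<xi> \<noteq> 0"
    then show "f \<xi> * indicator {\<xi>. \<bar>\<xi>\<bar> < s} \<xi> \<le> ?h \<xi> + ?h (- \<xi>)"
      using le[of \<xi>] le[of "- \<xi>"] even[of \<xi>] by (auto simp: indicator_def)
  qed
  also have "\<dots> = (\<integral>\<^sup>+\<xi>. ?h \<xi> \<partial>lborel) + (\<integral>\<^sup>+\<xi>. ?h (- \<xi>) \<partial>lborel)"
    by (rule nn_integral_add) measurable
  also have "(\<integral>\<^sup>+\<xi>. ?h (- \<xi>) \<partial>lborel) = (\<integral>\<^sup>+\<xi>. ?h \<xi> \<partial>lborel)"
    by (subst nn_integral_real_affine[where c = "-1" and t = 0 and f = ?h]) auto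
  finally show ?thesis by (simp add: mult_2)
qed

lemma nn_integral_const_atLeast_eq_top:
  fixes \<rho> :: real and k :: ennreal
  assumes "0 < k"
  shows "(\<integral>\<^sup>+r\<in>{\<rho>..}. k \<partial>lborel) = \<infinity>"
proof -
  have "emeasure lborel {\<rho>..} = \<infinity>"
  proof (rule ccontr)
    assume "emeasure lborel {\<rho>..} \<noteq> \<infinity>"
    then obtain v where v: "emeasure lborel {\<rho>..} = ennreal v" "0 \<le> v"
      by (cases "emeasure lborel {\<rho>..}") auto
    have "emeasure lborel {\<rho>..\<rho> + (v + 1)} \<le> emeasure lborel {\<rho>..}"
      by (intro emeasure_mono) auto
    then show False using v by simp
  qed
  then show ?thesis using assms by (simp add: nn_integral_cmult_indicator ennreal_mult_top)
qed

section \<open>Bounds for the symbol\<close>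

text \<open>The analytic data extracted from the process: \<open>q\<close> stands for the real part
  of the symbol, with the killing term already removed.\<close>

locale quasi_unimodal_symbol =
  fixes q :: "real \<Rightarrow> real \<Rightarrow> real" and c :: "real \<Rightarrow> real" and \<nu> :: "real \<Rightarrow> real measure"
    and y0 C :: real
  assumes quasi_unimodal: "\<And>x. quasi_unimodal_levy_measure (\<nu> x) y0"
    and c_nonneg: "\<And>x. 0 \<le> c x"
    and q_nonneg: "\<And>x \<xi>. 0 \<le> q x \<xi>"
    and q_eq: "\<And>x \<xi>. ennreal (q x \<xi>) =
      ennreal (c x * \<xi>\<^sup>2 / 2) + 2 * (\<integral>\<^sup>+z\<in>{0<..}. ennreal (1 - cos (\<xi> * z)) \<partial>\<nu> x)"
    and C_nonneg: "0 \<le> C"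
    and q_le: "\<And>x \<xi>. q x \<xi> \<le> C * (1 + \<xi>\<^sup>2)"
begin

lemma y0_nonneg: "0 \<le> y0"
  using quasi_unimodal[of 0] by (simp add: quasi_unimodal_levy_measure_def quasi_unimodal_levy_measure_axioms_def)

lemma q_even: "q x (- \<xi>) = q x \<xi>"
proof -
  have "ennreal (q x (- \<xi>)) = ennreal (q x \<xi>)" unfolding q_eq by simp
  then show ?thesis using q_nonneg by simp
qed

text \<open>At frequency 1 the diffusion part \<open>c x / 2\<close> is at most
  \<open>q x 1\<close>, hence at most \<open>2 * C\<close>.\<close>

lemma c_le: "c x \<le> 4 * C"
proof -
  have "ennreal (c x / 2) \<le> ennreal (q x 1)"
    using q_eq[of x 1] by simp
  then show ?thesis using q_nonneg[of x 1] q_le[of x 1] by simp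
qed

lemma q_upper:
  assumes "0 < \<xi>"
  shows "ennreal (q x \<xi>) \<le> ennreal (\<xi>\<^sup>2) * (ennreal (2 * C) + 2 * tail_moment (\<nu> x) (2 / \<xi>))"
proof -
  interpret quasi_unimodal_levy_measure "\<nu> x" y0 by (rule quasi_unimodal)
  have "c x * \<xi>\<^sup>2 / 2 \<le> \<xi>\<^sup>2 * (2 * C)"
    using mult_right_mono[OF c_le[of x], of "\<xi>\<^sup>2"] by (simp add: mult_ac)
  then have "ennreal (c x * \<xi>\<^sup>2 / 2) \<le> ennreal (\<xi>\<^sup>2) * ennreal (2 * C)"
    using C_nonneg by (simp add: ennreal_mult[symmetric] ennreal_leI)
  moreover have "2 * (\<integral>\<^sup>+z\<in>{0<..}. ennreal (1 - cos (\<xi> * z)) \<partial>\<nu> x)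
      \<le> 2 * (ennreal (\<xi>\<^sup>2) * tail_moment (\<nu> x) (2 / \<xi>))"
    using assms by (intro mult_left_mono nn_integral_one_minus_cos_le) auto
  ultimately show ?thesis unfolding q_eq distrib_left by (simp add: add_mono mult_ac)
qed

lemma q_lower:
  assumes "0 < \<xi>" "y0 < pi / 2 / \<xi>"
  shows "ennreal (1 / 2 * \<xi>\<^sup>2) * tail_moment (\<nu> x) (pi / 2 / \<xi>) \<le> ennreal (q x \<xi>)"
proof -
  interpret quasi_unimodal_levy_measure "\<nu> x" y0 by (rule quasi_unimodal)
  have "ennreal (\<xi>\<^sup>2 / 2) * tail_moment (\<nu> x) (pi / (2 * \<xi>))
    \<le> 2 * (\<integral>\<^sup>+z\<in>{0<..}. ennreal (1 - cos (\<xi> * z)) \<partial>\<nu> x)"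
    using assms by (intro nn_integral_one_minus_cos_ge) auto
  also have "\<dots> \<le> ennreal (q x \<xi>)" unfolding q_eq by simp
  finally show ?thesis by simp
qed

text \<open>Unlike \<open>q_lower\<close>, this bound holds at every positive frequency. It keeps
  the supremum of the symbol away from zero on ranges of \<open>\<xi>\<close> bounded away from the
  origin.\<close>

lemma tail_le_q:
  assumes "0 < \<xi>" "y0 + 3 * pi / \<xi> \<le> M"
  shows "emeasure (\<nu> x) {M<..} \<le> ennreal (q x \<xi>)"
proof -
  interpret quasi_unimodal_levy_measure "\<nu> x" y0 by (rule quasi_unimodal)
  \<comment> \<open>\<open>A\<close> must have phase \<open>pi / 2\<close> modulo
    \<open>2 * pi\<close> and exceed \<open>y0\<close>. Rounding up costs at most one period, so
    \<open>A * \<xi>\<close> is at most \<open>y0 * \<xi> + 5 / 2 * pi\<close>, within the allowance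
    of \<open>3 * pi\<close>.\<close>
  define k where "k = nat \<lceil>y0 * \<xi> / (2 * pi)\<rceil>"
  define A where "A = (pi / 2 + 2 * pi * real k) / \<xi>"
  have "0 \<le> y0 * \<xi> / (2 * pi)" using y0_nonneg assms by simp
  then have "y0 * \<xi> / (2 * pi) \<le> real k" "real k \<le> y0 * \<xi> / (2 * pi) + 1"
    using ceiling_correct[of "y0 * \<xi> / (2 * pi)"] by (auto simp: k_def)
  then have "y0 * \<xi> \<le> 2 * pi * real k" "2 * pi * real k \<le> y0 * \<xi> + 2 * pi"
    by (auto simp: field_simps)
  moreover have "A * \<xi> = pi / 2 + 2 * pi * real k" using assms(1) by (simp add: A_def)
  moreover have "(y0 + 3 * pi / \<xi>) * \<xi> = y0 * \<xi> + 3 * pi"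
    using assms(1) by (simp add: distrib_right)
  ultimately have "y0 * \<xi> < A * \<xi>" "A * \<xi> \<le> (y0 + 3 * pi / \<xi>) * \<xi>"
    using pi_gt_zero by linarith+
  then have A: "y0 < A" "A \<le> M" "0 < A" using assms y0_nonneg by auto
  have "emeasure (\<nu> x) {M<..} \<le> emeasure (\<nu> x) {A<..}"
    using A by (intro emeasure_mono) auto
  also have "\<dots> \<le> 2 * (\<integral>\<^sup>+z\<in>{A<..}. ennreal (1 - cos (\<xi> * z)) \<partial>\<nu> x)"
    using A assms by (intro tail_le_nn_integral_one_minus_cos[of _ _ k]) (auto simp: A_def)
  also have "\<dots> \<le> 2 * (\<integral>\<^sup>+z\<in>{0<..}. ennreal (1 - cos (\<xi> * z)) \<partial>\<nu> x)"
    using A by (intro mult_left_mono nn_integral_mono) (auto simp: indicator_def)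
  also have "\<dots> \<le> ennreal (q x \<xi>)" unfolding q_eq by simp
  finally show ?thesis .
qed

abbreviation S where "S r \<equiv> SUP x. tail_moment (\<nu> x) r"
abbreviation J where "J r \<equiv> INF x. tail_moment (\<nu> x) r"
abbreviation Q where "Q \<xi> \<equiv> SUP x. ennreal (q x \<xi>)"
abbreviation I where "I \<xi> \<equiv> INF x. ennreal (q x \<xi>)"

lemma S_mono: "r \<le> s \<Longrightarrow> S r \<le> S s"
  by (intro SUP_mono' tail_moment_mono)

lemma borel_measurable_S [measurable]: "S \<in> borel_measurable borel"
  by (intro mono_imp_borel_measurable_ennreal monoI S_mono)

lemma borel_measurable_J [measurable]: "J \<in> borel_measurable borel"
  by (intro mono_imp_borel_measurable_ennreal monoI INF_mono' tail_moment_mono)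

lemma S_scale:
  assumes "0 < \<rho>" "\<rho> \<le> r"
  shows "S r \<le> ennreal ((r / \<rho>)\<^sup>2) * S \<rho>"
proof (rule SUP_least)
  fix x
  interpret quasi_unimodal_levy_measure "\<nu> x" y0 by (rule quasi_unimodal)
  have "tail_moment (\<nu> x) r \<le> ennreal ((r / \<rho>)\<^sup>2) * tail_moment (\<nu> x) \<rho>"
    using assms by (rule tail_moment_scale)
  also have "\<dots> \<le> ennreal ((r / \<rho>)\<^sup>2) * S \<rho>"
    by (intro mult_left_mono SUP_upper) auto
  finally show "tail_moment (\<nu> x) r \<le> ennreal ((r / \<rho>)\<^sup>2) * S \<rho>" .
qed

lemma Q_upper:
  assumes "0 < \<xi>"
  shows "Q \<xi> \<le> ennreal (1 * \<xi>\<^sup>2) * (ennreal (2 * C) + 2 * S (2 / \<xi>))"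
proof (rule SUP_least)
  fix x
  show "ennreal (q x \<xi>) \<le> ennreal (1 * \<xi>\<^sup>2) * (ennreal (2 * C) + 2 * S (2 / \<xi>))"
    using q_upper[OF assms, of x]
    by (rule order_trans) (auto intro!: mult_left_mono add_left_mono SUP_upper)
qed

lemma Q_lower:
  assumes "0 < \<xi>" "y0 < pi / 2 / \<xi>"
  shows "ennreal (1 / 2 * \<xi>\<^sup>2) * S (pi / 2 / \<xi>) \<le> Q \<xi>"
  unfolding SUP_mult_left_ennreal by (intro SUP_mono' q_lower assms)

lemma I_lower:
  assumes "0 < \<xi>" "y0 < pi / 2 / \<xi>"
  shows "ennreal (1 / 2 * \<xi>\<^sup>2) * J (pi / 2 / \<xi>) \<le> I \<xi>"
proof (rule INF_greatest)
  fix x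
  have "ennreal (1 / 2 * \<xi>\<^sup>2) * J (pi / 2 / \<xi>) \<le> ennreal (1 / 2 * \<xi>\<^sup>2) * tail_moment (\<nu> x) (pi / 2 / \<xi>)"
    by (intro mult_left_mono INF_lower) auto
  also have "\<dots> \<le> ennreal (q x \<xi>)" using assms by (rule q_lower)
  finally show "ennreal (1 / 2 * \<xi>\<^sup>2) * J (pi / 2 / \<xi>) \<le> ennreal (q x \<xi>)" .
qed

text \<open>The diffusion contributes at most \<open>2 * C * \<xi>\<^sup>2\<close> to the bound of
  \<open>q_upper\<close>, which is less than half of \<open>I \<xi>\<close> by \<open>large\<close>.
  The jump part \<open>2 * \<xi>\<^sup>2 * D\<close> therefore supplies at least the other
  half.\<close>

lemma I_upper:
  assumes "0 < \<xi>" and large: "ennreal (4 * C) < I \<xi> / ennreal (\<xi>\<^sup>2)"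
  shows "I \<xi> \<le> ennreal (4 * \<xi>\<^sup>2) * J (2 / \<xi>)"
proof -
  have "I \<xi> \<le> ennreal (q 0 \<xi>)" by (rule INF_lower) simp
  then obtain p where p: "I \<xi> = ennreal p" "0 \<le> p"
    by (cases "I \<xi>") (auto simp: top_unique)
  have "4 * C < p / \<xi>\<^sup>2"
    using large assms(1) p C_nonneg by (simp add: divide_ennreal ennreal_less_iff)
  then have Cp: "4 * C * \<xi>\<^sup>2 < p" using assms(1) by (simp add: field_simps)
  have "ennreal (1 / (4 * \<xi>\<^sup>2)) * I \<xi> \<le> J (2 / \<xi>)"
  proof (rule INF_greatest)
    fix x
    let ?t = "tail_moment (\<nu> x) (2 / \<xi>)"
    have le: "I \<xi> \<le> ennreal (\<xi>\<^sup>2) * (ennreal (2 * C) + 2 * ?t)"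
      using q_upper[OF assms(1), of x] by (rule order_trans[OF INF_lower, rotated]) simp
    show "ennreal (1 / (4 * \<xi>\<^sup>2)) * I \<xi> \<le> ?t"
    proof (cases ?t)
      case (real t)
      have "ennreal (2 * C) + 2 * ?t = ennreal (2 * C + 2 * t)"
        using real C_nonneg by (simp add: ennreal_plus ennreal_mult)
      then have "ennreal p \<le> ennreal (\<xi>\<^sup>2 * (2 * C + 2 * t))"
        using le real p C_nonneg by (simp add: ennreal_mult)
      then have "p \<le> \<xi>\<^sup>2 * (2 * C + 2 * t)"
        using real C_nonneg by (subst (asm) ennreal_le_iff) auto
      with Cp have "p \<le> 4 * \<xi>\<^sup>2 * t" by (simp add: algebra_simps)
      then have "1 / (4 * \<xi>\<^sup>2) * p \<le> t" using assms(1) by (simp add: field_simps)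
      then show ?thesis using real p by (simp add: ennreal_mult[symmetric] ennreal_leI)
    qed simp
  qed
  then have "ennreal (4 * \<xi>\<^sup>2) * (ennreal (1 / (4 * \<xi>\<^sup>2)) * I \<xi>) \<le> ennreal (4 * \<xi>\<^sup>2) * J (2 / \<xi>)"
    by (rule mult_left_mono) simp
  moreover have "ennreal (4 * \<xi>\<^sup>2) * (ennreal (1 / (4 * \<xi>\<^sup>2)) * I \<xi>) = I \<xi>"
    using assms(1) by (simp add: mult.assoc[symmetric] ennreal_mult[symmetric] del: mult.assoc)
  ultimately show ?thesis by simp
qed

end

section \<open>Comparison of the integrals\<close>

context quasi_unimodal_symbol
begin

text \<open>The bounded diffusion term must not spoil the divergence. If
  \<open>S \<rho> = 0\<close>, then \<open>S\<close> vanishes beyond \<open>\<rho>\<close> and the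
  integrand is a positive constant; otherwise \<open>S r \<ge> S \<rho> > 0\<close> absorbs
  \<open>2 * C\<close> up to a factor.\<close>

lemma recurrence_integral_forward:
  assumes "0 < \<rho>" and inf: "(\<integral>\<^sup>+r\<in>{\<rho>..}. inverse (S r) \<partial>lborel) = \<infinity>"
  shows "\<exists>s>0. (\<integral>\<^sup>+\<xi>\<in>{\<xi>. \<bar>\<xi>\<bar> < s}. inverse (Q \<xi>) \<partial>lborel) = \<infinity>"
proof -
  let ?G = "\<lambda>r. ennreal (2 * C) + 2 * S r"
  have "(\<integral>\<^sup>+r\<in>{\<rho>..}. inverse (?G r) \<partial>lborel) = \<infinity>"
  proof (cases "S \<rho> = 0")
    case True
    have "S r = 0" if "\<rho> \<le> r" for r
      using S_scale[OF assms(1) that] unfolding True by simp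
    then have "(\<integral>\<^sup>+r\<in>{\<rho>..}. inverse (?G r) \<partial>lborel) = (\<integral>\<^sup>+r\<in>{\<rho>..}. inverse (ennreal (2 * C)) \<partial>lborel)"
      by (intro nn_integral_cong) (auto simp: indicator_def)
    also have "\<dots> = \<infinity>"
      by (rule nn_integral_const_atLeast_eq_top) (simp add: ennreal_inverse_positive)
    finally show ?thesis .
  next
    case False
    have "\<exists>L\<ge>0. ennreal (2 * C) \<le> ennreal L * S \<rho>"
    proof (cases "S \<rho>")
      case (real p)
      with False have "0 < p" by (cases "p = 0") auto
      have "ennreal (2 * C) = ennreal (2 * C / p) * ennreal p"
        using \<open>0 < p\<close> C_nonneg by (simp add: ennreal_mult[symmetric])
      then show ?thesis using real(2) \<open>0 < p\<close> C_nonneg by (intro exI[of _ "2 * C / p"]) simp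
    next
      case top
      then show ?thesis by (intro exI[of _ 1]) (simp only: ennreal_1 mult_1_left top_greatest zero_le_one simp_thms)
    qed
    then obtain L where L: "0 \<le> L" "ennreal (2 * C) \<le> ennreal L * S \<rho>" by blast
    have G_le: "?G r \<le> ennreal (L + 2) * S r" if "\<rho> \<le> r" for r
    proof -
      have "ennreal (2 * C) \<le> ennreal L * S r"
        using L(2) by (rule order_trans) (intro mult_left_mono S_mono that, simp)
      then show ?thesis using L(1) by (simp add: distrib_right add_right_mono)
    qed
    have "\<infinity> = ennreal (1 / (L + 2)) * (\<integral>\<^sup>+r\<in>{\<rho>..}. inverse (S r) \<partial>lborel)"
      using L(1) by (simp add: inf ennreal_mult_top)
    also have "\<dots> = (\<integral>\<^sup>+r. ennreal (1 / (L + 2)) * (inverse (S r) * indicator {\<rho>..} r) \<partial>lborel)"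
      by (rule nn_integral_cmult[symmetric]) measurable
    also have "\<dots> \<le> (\<integral>\<^sup>+r\<in>{\<rho>..}. inverse (?G r) \<partial>lborel)"
    proof (intro nn_integral_mono)
      fix r
      show "ennreal (1 / (L + 2)) * (inverse (S r) * indicator {\<rho>..} r) \<le> inverse (?G r) * indicator {\<rho>..} r"
      proof (cases "\<rho> \<le> r")
        case True
        have "ennreal (1 / (L + 2)) * inverse (S r) = inverse (ennreal (L + 2) * S r)"
          using L(1) by (intro inverse_ennreal_times[symmetric]) simp
        also have "\<dots> \<le> inverse (?G r)"
          by (rule inverse_ennreal_antimono[OF G_le[OF True]])
        finally show ?thesis using True by simp
      qed simp
    qed
    finally show ?thesis by (simp add: top_unique)
  qed
  moreover have "(\<integral>\<^sup>+\<xi>\<in>{0<..2 / \<rho>}. inverse (ennreal (1 * \<xi>\<^sup>2) * ?G (2 / \<xi>)) \<partial>lborel)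
      = ennreal (1 / (1 * 2)) * (\<integral>\<^sup>+r\<in>{2 / (2 / \<rho>)..}. inverse (?G r) \<partial>lborel)"
    using assms(1) by (intro nn_integral_reciprocal_inverse) auto
  ultimately have "\<infinity> = (\<integral>\<^sup>+\<xi>\<in>{0<..2 / \<rho>}. inverse (ennreal (1 * \<xi>\<^sup>2) * ?G (2 / \<xi>)) \<partial>lborel)"
    using assms(1) by (simp add: ennreal_mult_top)
  \<comment> \<open>The summand 1 only brings the endpoint \<open>2 / \<rho>\<close> inside the open
    symmetric interval.\<close>
  also have "\<dots> \<le> (\<integral>\<^sup>+\<xi>\<in>{\<xi>. \<bar>\<xi>\<bar> < 2 / \<rho> + 1}. inverse (Q \<xi>) \<partial>lborel)"
  proof (intro nn_integral_mono)
    fix \<xi>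
    show "inverse (ennreal (1 * \<xi>\<^sup>2) * ?G (2 / \<xi>)) * indicator {0<..2 / \<rho>} \<xi>
      \<le> inverse (Q \<xi>) * indicator {\<xi>. \<bar>\<xi>\<bar> < 2 / \<rho> + 1} \<xi>"
    proof (cases "\<xi> \<in> {0<..2 / \<rho>}")
      case True
      then show ?thesis using inverse_ennreal_antimono[OF Q_upper[of \<xi>]] by (simp add: indicator_def)
    qed simp
  qed
  finally show ?thesis using assms(1)
    by (intro exI[of _ "2 / \<rho> + 1"]) (simp add: top_unique add_pos_pos)
qed

text \<open>Beyond \<open>A\<close> the tails contribute nothing, so all truncated moments are
  dominated by the one at \<open>A\<close>. That one is bounded uniformly in \<open>x\<close> by
  \<open>q_lower\<close> at the frequency with quarter period \<open>A\<close>, together with the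
  growth bound on \<open>q\<close>.\<close>

lemma S_bounded_if_tail_vanishes:
  assumes "\<And>x. emeasure (\<nu> x) {M<..} = 0"
  obtains L where "0 \<le> L" "\<And>r. S r \<le> ennreal L"
proof -
  define A where "A = y0 + \<bar>M\<bar> + 1"
  define \<xi> where "\<xi> = pi / 2 / A"
  have A: "0 < A" "y0 < A" "M \<le> A" using y0_nonneg by (auto simp: A_def)
  then have \<xi>: "0 < \<xi>" "pi / 2 / \<xi> = A" by (auto simp: \<xi>_def)
  define L where "L = 2 / \<xi>\<^sup>2 * (C * (1 + \<xi>\<^sup>2))"
  have L: "tail_moment (\<nu> x) A \<le> ennreal L" for x
  proof -
    have "ennreal (1 / 2 * \<xi>\<^sup>2) * tail_moment (\<nu> x) A \<le> ennreal (q x \<xi>)"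
      using q_lower[of \<xi> x] \<xi> A by simp
    also have "\<dots> \<le> ennreal (C * (1 + \<xi>\<^sup>2))" by (intro ennreal_leI q_le)
    finally have "ennreal (2 / \<xi>\<^sup>2) * (ennreal (1 / 2 * \<xi>\<^sup>2) * tail_moment (\<nu> x) A)
        \<le> ennreal (2 / \<xi>\<^sup>2) * ennreal (C * (1 + \<xi>\<^sup>2))"
      by (rule mult_left_mono) simp
    also have "\<dots> = ennreal L" using C_nonneg by (simp add: L_def ennreal_mult[symmetric])
    also have "ennreal (2 / \<xi>\<^sup>2) * (ennreal (1 / 2 * \<xi>\<^sup>2) * tail_moment (\<nu> x) A)
        = ennreal (2 / \<xi>\<^sup>2 * (1 / 2 * \<xi>\<^sup>2)) * tail_moment (\<nu> x) A"
      by (subst ennreal_mult) (auto simp: mult.assoc)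
    also have "2 / \<xi>\<^sup>2 * (1 / 2 * \<xi>\<^sup>2) = 1" using \<xi>(1) by simp
    finally show ?thesis by simp
  qed
  have zero: "emeasure (\<nu> x) {y<..} = 0" if "A < y" for x y
  proof -
    interpret quasi_unimodal_levy_measure "\<nu> x" y0 by (rule quasi_unimodal)
    have "emeasure (\<nu> x) {y<..} \<le> emeasure (\<nu> x) {M<..}"
      using that A by (intro emeasure_mono) auto
    then show ?thesis using assms by simp
  qed
  have "tail_moment (\<nu> x) r \<le> tail_moment (\<nu> x) A" for x r
    unfolding tail_moment_def
  proof (intro nn_integral_mono)
    fix y
    show "ennreal y * emeasure (\<nu> x) {y<..} * indicator {0..r} y
        \<le> ennreal y * emeasure (\<nu> x) {y<..} * indicator {0..A} y"
      using zero[of y x] by (cases "A < y") (auto simp: indicator_def)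
  qed
  then have "S r \<le> ennreal L" for r
    using L by (intro SUP_least) (blast intro: order_trans)
  moreover have "0 \<le> L" using C_nonneg by (simp add: L_def)
  ultimately show ?thesis using that by blast
qed

text \<open>
  For large \<open>s\<close> the integral of \<open>1 / Q\<close> might diverge because of zeros of \<open>Q\<close> away from the
  origin. These occur only if all \<open>\<nu> x\<close> live on a common bounded interval, in which case \<open>S\<close>
  is bounded and the integral of \<open>1 / S\<close> diverges anyway.
\<close>

lemma recurrence_integral_backward:
  assumes "0 < \<rho>" "0 < s" and inf: "(\<integral>\<^sup>+\<xi>\<in>{\<xi>. \<bar>\<xi>\<bar> < s}. inverse (Q \<xi>) \<partial>lborel) = \<infinity>"
  shows "(\<integral>\<^sup>+r\<in>{\<rho>..}. inverse (S r) \<partial>lborel) = \<infinity>"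
proof (cases "\<exists>M. \<forall>x. emeasure (\<nu> x) {M<..} = 0")
  case True
  then obtain L where L: "0 \<le> L" "\<And>r. S r \<le> ennreal L"
    using S_bounded_if_tail_vanishes by blast
  have "\<infinity> = (\<integral>\<^sup>+r\<in>{\<rho>..}. inverse (ennreal L) \<partial>lborel)"
    by (rule nn_integral_const_atLeast_eq_top[symmetric]) (simp add: ennreal_inverse_positive)
  also have "\<dots> \<le> (\<integral>\<^sup>+r\<in>{\<rho>..}. inverse (S r) \<partial>lborel)"
    using L by (intro nn_integral_mono mult_right_mono inverse_ennreal_antimono) auto
  finally show ?thesis by (simp add: top_unique)
next
  case False
  \<comment> \<open>For \<open>\<xi> \<le> s'\<close> the quarter period exceeds both
    \<open>y0\<close>, so that \<open>Q_lower\<close> applies, and \<open>\<rho>\<close>, so that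
    the substituted range lies in \<open>{\<rho>..}\<close>.\<close>
  define s' where "s' = min s (pi / 2 / (\<rho> + y0 + 1))"
  have den: "0 < \<rho> + y0 + 1" using assms(1) y0_nonneg by simp
  then have s': "0 < s'" "s' \<le> s" using assms(2) by (auto simp: s'_def)
  have s'_le: "s' \<le> pi / 2 / (\<rho> + y0 + 1)" by (simp add: s'_def)
  have large: "\<rho> + y0 + 1 \<le> pi / 2 / \<xi>" if "0 < \<xi>" "\<xi> \<le> s'" for \<xi>
  proof -
    have "\<xi> \<le> pi / 2 / (\<rho> + y0 + 1)" using that s'_le by simp
    then have "\<xi> * (\<rho> + y0 + 1) \<le> pi / 2" by (subst (asm) pos_le_divide_eq[OF den])
    then show ?thesis using that by (subst pos_le_divide_eq) (auto simp: mult.commute)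
  qed
  \<comment> \<open>With this \<open>M\<close>, \<open>tail_le_q\<close> applies simultaneously to
    all \<open>\<xi> \<ge> s'\<close>.\<close>
  define M where "M = y0 + 3 * pi / s'"
  from False obtain x0 where "emeasure (\<nu> x0) {M<..} \<noteq> 0" by blast
  define p where "p = emeasure (\<nu> x0) {M<..}"
  have "p \<noteq> 0" unfolding p_def by fact
  then have inverse_p: "inverse p < \<infinity>"
    by (simp add: less_top[symmetric])
  have Q_ge_p: "p \<le> Q \<xi>" if "s' \<le> \<xi>" for \<xi>
  proof -
    have "y0 + 3 * pi / \<xi> \<le> M"
      using that s' unfolding M_def by (intro add_left_mono divide_left_mono) auto
    then have "p \<le> ennreal (q x0 \<xi>)"
      unfolding p_def using that s' by (intro tail_le_q) auto
    also have "\<dots> \<le> Q \<xi>" by (rule SUP_upper) simp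
    finally show ?thesis .
  qed
  let ?h = "\<lambda>\<xi>. inverse (ennreal (1 / 2 * \<xi>\<^sup>2) * S (pi / 2 / \<xi>))"
  \<comment> \<open>Away from the origin the constant \<open>inverse p\<close> is a finite majorant
    and contributes at most a finite amount, so the divergence must come from
    \<open>{0<..s'}\<close>.\<close>
  have "\<infinity> \<le> 2 * (\<integral>\<^sup>+\<xi>\<in>{0<..s}. (?h \<xi> * indicator {0<..s'} \<xi> + inverse p) \<partial>lborel)"
    unfolding inf[symmetric]
  proof (rule nn_integral_symmetric_interval_le)
    fix \<xi> :: real assume \<xi>: "0 < \<xi>" "\<xi> < s"
    show "inverse (Q \<xi>) \<le> ?h \<xi> * indicator {0<..s'} \<xi> + inverse p"
    proof (cases "\<xi> \<le> s'")
      case True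
      then have "inverse (Q \<xi>) \<le> ?h \<xi>"
        using \<xi> large[of \<xi>] assms(1) by (intro inverse_ennreal_antimono Q_lower) auto
      then show ?thesis using True \<xi> by (auto intro: add_increasing2)
    next
      case False
      then show ?thesis using Q_ge_p[of \<xi>]
        by (intro add_increasing inverse_ennreal_antimono) auto
    qed
  qed (auto simp: q_even)
  also have "(\<integral>\<^sup>+\<xi>\<in>{0<..s}. (?h \<xi> * indicator {0<..s'} \<xi> + inverse p) \<partial>lborel)
      = (\<integral>\<^sup>+\<xi>. ?h \<xi> * indicator {0<..s'} \<xi> + inverse p * indicator {0<..s} \<xi> \<partial>lborel)"
    using s' by (intro nn_integral_cong) (auto simp: indicator_def)
  also have "\<dots> = (\<integral>\<^sup>+\<xi>\<in>{0<..s'}. ?h \<xi> \<partial>lborel) + inverse p * ennreal s"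
    using assms(2) by (subst nn_integral_add) (auto simp: nn_integral_cmult_indicator)
  also have "(\<integral>\<^sup>+\<xi>\<in>{0<..s'}. ?h \<xi> \<partial>lborel)
      = ennreal (1 / (1 / 2 * (pi / 2))) * (\<integral>\<^sup>+r\<in>{pi / 2 / s'..}. inverse (S r) \<partial>lborel)"
    using s' by (intro nn_integral_reciprocal_inverse) auto
  finally have "(\<integral>\<^sup>+r\<in>{pi / 2 / s'..}. inverse (S r) \<partial>lborel) = \<infinity>"
    using inverse_p by (auto simp: top_unique ennreal_mult_eq_top_iff)
  moreover have "(\<integral>\<^sup>+r\<in>{pi / 2 / s'..}. inverse (S r) \<partial>lborel) \<le> (\<integral>\<^sup>+r\<in>{\<rho>..}. inverse (S r) \<partial>lborel)"
    using large[of s'] s' y0_nonneg by (intro nn_integral_mono) (auto simp: indicator_def)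
  ultimately show ?thesis by (simp add: top_unique)
qed

lemma transience_integral_forward:
  assumes "\<forall>\<^sub>F \<rho> in at_top. (\<integral>\<^sup>+r\<in>{\<rho>..}. inverse (J r) \<partial>lborel) < \<infinity>"
  shows "\<exists>s>0. (\<integral>\<^sup>+\<xi>\<in>{\<xi>. \<bar>\<xi>\<bar> < s}. inverse (I \<xi>) \<partial>lborel) < \<infinity>"
proof -
  have "\<forall>\<^sub>F \<rho> in at_top. y0 < \<rho> \<and> (\<integral>\<^sup>+r\<in>{\<rho>..}. inverse (J r) \<partial>lborel) < \<infinity>"
    using assms by (intro eventually_conj eventually_gt_at_top)
  then obtain \<rho> where \<rho>: "y0 < \<rho>" "(\<integral>\<^sup>+r\<in>{\<rho>..}. inverse (J r) \<partial>lborel) < \<infinity>"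
    using eventually_happens'[OF trivial_limit_at_top_linorder] by blast
  then have pos: "0 < \<rho>" using y0_nonneg by simp
  \<comment> \<open>The frequency \<open>s\<close> corresponds to \<open>r = \<rho>\<close>; as
    \<open>\<rho> > y0\<close>, \<open>I_lower\<close> is available for all \<open>\<xi>\<close>
    below \<open>s\<close>.\<close>
  define s where "s = pi / 2 / \<rho>"
  have s: "0 < s" "pi / 2 / s = \<rho>" using pos by (auto simp: s_def)
  let ?h = "\<lambda>\<xi>. inverse (ennreal (1 / 2 * \<xi>\<^sup>2) * J (pi / 2 / \<xi>))"
  have "(\<integral>\<^sup>+\<xi>\<in>{\<xi>. \<bar>\<xi>\<bar> < s}. inverse (I \<xi>) \<partial>lborel) \<le> 2 * (\<integral>\<^sup>+\<xi>\<in>{0<..s}. ?h \<xi> \<partial>lborel)"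
  proof (rule nn_integral_symmetric_interval_le)
    fix \<xi> :: real assume \<xi>: "0 < \<xi>" "\<xi> < s"
    have "pi / 2 / s \<le> pi / 2 / \<xi>" using \<xi> s by (intro divide_left_mono) auto
    then show "inverse (I \<xi>) \<le> ?h \<xi>"
      using \<xi> s \<rho>(1) by (intro inverse_ennreal_antimono I_lower) auto
  qed (auto simp: q_even)
  also have "(\<integral>\<^sup>+\<xi>\<in>{0<..s}. ?h \<xi> \<partial>lborel)
      = ennreal (1 / (1 / 2 * (pi / 2))) * (\<integral>\<^sup>+r\<in>{pi / 2 / s..}. inverse (J r) \<partial>lborel)"
    using s by (intro nn_integral_reciprocal_inverse) auto
  also have "2 * \<dots> < \<infinity>"
    using \<rho>(2) unfolding s(2) by (simp add: ennreal_mult_less_top)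
  finally show ?thesis using s(1) by blast
qed

lemma transience_integral_backward:
  assumes lim: "((\<lambda>\<xi>. I \<xi> / ennreal (\<xi>\<^sup>2)) \<longlongrightarrow> \<infinity>) (at 0)"
    and "0 < s" and fin: "(\<integral>\<^sup>+\<xi>\<in>{\<xi>. \<bar>\<xi>\<bar> < s}. inverse (I \<xi>) \<partial>lborel) < \<infinity>"
  shows "\<forall>\<^sub>F \<rho> in at_top. (\<integral>\<^sup>+r\<in>{\<rho>..}. inverse (J r) \<partial>lborel) < \<infinity>"
proof -
  \<comment> \<open>The limit hypothesis enters only to supply the threshold \<open>4 * C\<close>
    required by \<open>I_upper\<close> near the origin.\<close>
  have "\<forall>\<^sub>F \<xi> in at 0. ennreal (4 * C) < I \<xi> / ennreal (\<xi>\<^sup>2)"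
    using lim by (rule order_tendstoD) simp
  then obtain d where d: "0 < d" "\<And>\<xi>. \<xi> \<noteq> 0 \<Longrightarrow> \<bar>\<xi>\<bar> < d \<Longrightarrow> ennreal (4 * C) < I \<xi> / ennreal (\<xi>\<^sup>2)"
    unfolding eventually_at by (auto simp: dist_real_def)
  define m where "m = min s d"
  have m: "0 < m" "m \<le> s" "m \<le> d" using assms(2) d(1) by (auto simp: m_def)
  have "(\<integral>\<^sup>+r\<in>{\<rho>..}. inverse (J r) \<partial>lborel) < \<infinity>" if "2 / m < \<rho>" for \<rho>
  proof -
    have "0 < 2 / m" using m by simp
    with that have pos: "0 < \<rho>" by linarith
    have small: "2 / \<rho> < m" using that pos m by (simp add: field_simps)
    have "ennreal (1 / (4 * 2)) * (\<integral>\<^sup>+r\<in>{2 / (2 / \<rho>)..}. inverse (J r) \<partial>lborel)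
      = (\<integral>\<^sup>+\<xi>\<in>{0<..2 / \<rho>}. inverse (ennreal (4 * \<xi>\<^sup>2) * J (2 / \<xi>)) \<partial>lborel)"
      using pos by (intro nn_integral_reciprocal_inverse[symmetric]) auto
    also have "\<dots> \<le> (\<integral>\<^sup>+\<xi>\<in>{\<xi>. \<bar>\<xi>\<bar> < s}. inverse (I \<xi>) \<partial>lborel)"
    proof (intro nn_integral_mono)
      fix \<xi>
      show "inverse (ennreal (4 * \<xi>\<^sup>2) * J (2 / \<xi>)) * indicator {0<..2 / \<rho>} \<xi>
        \<le> inverse (I \<xi>) * indicator {\<xi>. \<bar>\<xi>\<bar> < s} \<xi>"
      proof (cases "\<xi> \<in> {0<..2 / \<rho>}")
        case True
        then have "inverse (ennreal (4 * \<xi>\<^sup>2) * J (2 / \<xi>)) \<le> inverse (I \<xi>)"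
          using small m d(2)[of \<xi>] by (intro inverse_ennreal_antimono I_upper) auto
        then show ?thesis using True small m by (simp add: indicator_def)
      qed simp
    qed
    finally have "ennreal (1 / (4 * 2)) * (\<integral>\<^sup>+r\<in>{2 / (2 / \<rho>)..}. inverse (J r) \<partial>lborel) < \<infinity>"
      using fin by (rule le_less_trans)
    then show ?thesis by (auto simp: ennreal_mult_less_top)
  qed
  then show ?thesis
    by (intro eventually_mono[OF eventually_gt_at_top[of "2 / m"]])
qed

end

section \<open>From the process to the analytic setting\<close>

lemma nice_feller_process_quasi_unimodal_symbol:
  assumes process: "nice_feller_process \<Omega> P X q a b c \<nu>"
    and unimodal: "uniformly_quasi_unimodal \<nu>"
  obtains y0 C where "quasi_unimodal_symbol (\<lambda>x \<xi>. Re (q x \<xi>)) c \<nu> y0 C"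
proof -
  interpret process: nice_feller_process \<Omega> P X q a b c \<nu> by fact
  obtain y0 where y0: "0 \<le> y0" "\<And>x. quasi_unimodal_from y0 (\<nu> x)"
    using unimodal unfolding uniformly_quasi_unimodal_def by blast
  obtain C where C: "0 \<le> C" "\<And>x \<xi>. cmod (q x \<xi>) \<le> C * (1 + \<xi>\<^sup>2)"
    using process.C2 by blast
  \<comment> \<open>Symmetry of each \<open>\<nu> x\<close> is part of
    \<open>quasi_unimodal_from\<close>; integrability and the null origin come from
    \<open>levy_kernel\<close>.\<close>
  have measure: "quasi_unimodal_levy_measure (\<nu> x) y0" for x
    using process.levy_kernel y0
    unfolding levy_kernel_def quasi_unimodal_from_def symmetric_measure_def
    by unfold_locales auto
  \<comment> \<open>At frequency 0 every other term of the Levy-Khintchine formula vanishes, so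
    \<open>C3\<close> forces \<open>a x = 0\<close>.\<close>
  have a_zero: "a x = 0" for x
    using process.C3[of x] unfolding process.levy_khintchine_repr levy_khintchine_def by simp
  have "quasi_unimodal_symbol (\<lambda>x \<xi>. Re (q x \<xi>)) c \<nu> y0 C"
  proof (rule quasi_unimodal_symbol.intro)
    fix x \<xi>
    interpret quasi_unimodal_levy_measure "\<nu> x" y0 by (rule measure)
    show "quasi_unimodal_levy_measure (\<nu> x) y0" by (rule measure)
    show "0 \<le> c x" "0 \<le> C" by (fact process.coefficients_nonneg C)+
    show "0 \<le> Re (q x \<xi>)"
      unfolding process.levy_khintchine_repr
      by (intro ennreal_Re_levy_khintchine process.coefficients_nonneg refl)
    show "ennreal (Re (q x \<xi>)) =
      ennreal (c x * \<xi>\<^sup>2 / 2) + 2 * (\<integral>\<^sup>+z\<in>{0<..}. ennreal (1 - cos (\<xi> * z)) \<partial>\<nu> x)"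
      unfolding process.levy_khintchine_repr
      by (subst ennreal_Re_levy_khintchine) (simp_all add: a_zero process.coefficients_nonneg)
    show "Re (q x \<xi>) \<le> C * (1 + \<xi>\<^sup>2)"
      using C(2)[of x \<xi>] complex_Re_le_cmod[of "q x \<xi>"] by linarith
  qed
  then show ?thesis by (rule that)
qed

theorem theorem3p9:
  fixes \<Omega> :: "'w measure" and P :: "real \<Rightarrow> 'w measure" and X :: "real \<Rightarrow> 'w \<Rightarrow> real"
    and q :: "real \<Rightarrow> real \<Rightarrow> complex"
    and a b c :: "real \<Rightarrow> real" and \<nu> :: "real \<Rightarrow> real measure"
  assumes process: "nice_feller_process \<Omega> P X q a b c \<nu>"
    and symmetric: "symmetric_symbol q"
    and unimodal: "uniformly_quasi_unimodal \<nu>"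
    and lsc: "\<And>U x. open U \<Longrightarrow>
      Liminf (at x) (\<lambda>y. emeasure (\<nu> y) ((\<lambda>z. z - y) ` U)) \<ge> emeasure (\<nu> x) ((\<lambda>z. z - x) ` U)"
  shows
    "(\<forall>\<rho>>0.
        (\<integral>\<^sup>+r\<in>{\<rho>..}. inverse (SUP x. \<integral>\<^sup>+y\<in>{0..r}. ennreal y * levy_tail \<nu> x y \<partial>lborel) \<partial>lborel) = \<infinity>
        \<longleftrightarrow> (\<exists>s>0. (\<integral>\<^sup>+\<xi>\<in>{\<xi>. \<bar>\<xi>\<bar> < s}. inverse (SUP x. ennreal (cmod (q x \<xi>))) \<partial>lborel) = \<infinity>))
     \<and>
     (((\<lambda>\<xi>. (INF x. ennreal (Re (q x \<xi>))) / ennreal (\<xi>\<^sup>2)) \<longlongrightarrow> \<infinity>) (at 0) \<longrightarrow>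
      (\<exists>y0>0. (INF x. \<integral>\<^sup>+y\<in>{y0..}. ennreal y * levy_tail \<nu> x y \<partial>lborel) > 0) \<longrightarrow>
        ((\<forall>\<^sub>F \<rho> in at_top.
            (\<integral>\<^sup>+r\<in>{\<rho>..}. inverse (INF x. \<integral>\<^sup>+y\<in>{0..r}. ennreal y * levy_tail \<nu> x y \<partial>lborel) \<partial>lborel) < \<infinity>)
         \<longleftrightarrow> (\<exists>s>0. (\<integral>\<^sup>+\<xi>\<in>{\<xi>. \<bar>\<xi>\<bar> < s}. inverse (INF x. ennreal (Re (q x \<xi>))) \<partial>lborel) < \<infinity>)))"
proof -
  obtain y0 C where "quasi_unimodal_symbol (\<lambda>x \<xi>. Re (q x \<xi>)) c \<nu> y0 C"
    using nice_feller_process_quasi_unimodal_symbol[OF process unimodal] .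
  then interpret quasi_unimodal_symbol "\<lambda>x \<xi>. Re (q x \<xi>)" c \<nu> y0 C .
  \<comment> \<open>A symmetric symbol is real and its real part is nonnegative, so the modulus in
    the first equivalence and the real part in the second are the same function.\<close>
  have cmod_q: "cmod (q x \<xi>) = Re (q x \<xi>)" for x \<xi>
  proof -
    have "cmod (q x \<xi>) = cmod (of_real (Re (q x \<xi>)))"
      using symmetric unfolding symmetric_symbol_def by metis
    then show ?thesis using q_nonneg by simp
  qed
  have tail: "(\<integral>\<^sup>+y\<in>{0..r}. ennreal y * levy_tail \<nu> x y \<partial>lborel) = tail_moment (\<nu> x) r" for x r
    by (simp add: tail_moment_def levy_tail_def)
  show ?thesis
    unfolding cmod_q tail
    using recurrence_integral_forward recurrence_integral_backward
      transience_integral_forward transience_integral_backward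
    by blast
qed

end
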